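(* Let $\mathscr{G}(X,Y)$ be the $2$-sort species of bicolored graphs and $\mathscr{P}^s(X,Y)$ the $2$-sort species of bicolored semi-point-determining graphs. Then $$\mathscr{G}(X,Y)=\mathscr{P}^s(\mathscr{E}_+(X),\mathscr{E}_+(Y)).$$
   Context: A bicolored graph is a finite simple graph whose vertices are properly colored with white and black (adjacent vertices have different colors; the coloring is part of the structure). A $2$-sort species $F(X,Y)$ assigns functorially to each pair $(U_1,U_2)$ of finite sets (and pairs of bijections) a finite set $F[U_1,U_2]$ (and bijections); equality means natural isomorphism. For $2$-sort species of bicolored graphs, structures on $(U_1,U_2)$ are bicolored graphs with set of white vertices $U_1$ (sort $X$) and set of black vertices $U_2$ (sort $Y$), with transport by relabeling. A bicolored graph is semi-point-determining if any two distinct vertices of the same color have distinct neighborhoods; the empty graph is semi-point-determining. $\mathscr{E}_+$ is the species of nonempty sets (one structure on each nonempty finite set). An $F(\mathscr{E}_+(X),\mathscr{E}_+(Y))$-structure on $(U_1,U_2)$ consists of partitions $\pi_1$ of $U_1$ and $\pi_2$ of $U_2$ into nonempty blocks together with an $F$-structure on $(\pi_1,\pi_2)$. *)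

theory Defs
  imports Main "HOL-Library.FSet" "HOL-Library.FuncSet" "HOL-Library.Disjoint_Sets"
begin

section \<open>Species on the finite subsets of a universe\<close>

text \<open>
  A species is given by its structures on each finite set (or pair of finite sets) of elements of
  a universe \<open>'u\<close>, and by the transport of structures along bijections.  In
  \<open>trans1 F U \<sigma> s\<close> and \<open>trans2 F U1 U2 \<sigma>1 \<sigma>2 s\<close>, the sets
  \<open>U\<close>, \<open>U1\<close>, \<open>U2\<close> are the sources of the bijections.  Since a
  bijection out of \<open>U\<close> is represented by a total function, functoriality includes that
  its values outside \<open>U\<close> are irrelevant.  The values of a species on infinite sets
  have no meaning.
\<close>

record ('u, 's) species1 =
  str1 :: "'u set \<Rightarrow> 's set"
  trans1 :: "'u set \<Rightarrow> ('u \<Rightarrow> 'u) \<Rightarrow> 's \<Rightarrow> 's"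

record ('u, 's) species2 =
  str2 :: "'u set \<Rightarrow> 'u set \<Rightarrow> 's set"
  trans2 :: "'u set \<Rightarrow> 'u set \<Rightarrow> ('u \<Rightarrow> 'u) \<Rightarrow> ('u \<Rightarrow> 'u) \<Rightarrow> 's \<Rightarrow> 's"

definition is_species1 :: "('u, 's) species1 \<Rightarrow> bool" where
  "is_species1 F \<longleftrightarrow>
    (\<forall>U. finite U \<longrightarrow> finite (str1 F U)) \<and>
    (\<forall>U V \<sigma>. finite U \<and> bij_betw \<sigma> U V \<longrightarrow>
       bij_betw (trans1 F U \<sigma>) (str1 F U) (str1 F V)) \<and>
    (\<forall>U \<sigma> s. finite U \<and> s \<in> str1 F U \<and> (\<forall>u\<in>U. \<sigma> u = u) \<longrightarrow>
       trans1 F U \<sigma> s = s) \<and>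
    (\<forall>U V W \<sigma> \<tau> \<rho> s. finite U \<and> bij_betw \<sigma> U V \<and> bij_betw \<tau> V W \<and>
       (\<forall>u\<in>U. \<rho> u = \<tau> (\<sigma> u)) \<and> s \<in> str1 F U \<longrightarrow>
       trans1 F U \<rho> s = trans1 F V \<tau> (trans1 F U \<sigma> s))"

definition is_species2 :: "('u, 's) species2 \<Rightarrow> bool" where
  "is_species2 F \<longleftrightarrow>
    (\<forall>U1 U2. finite U1 \<and> finite U2 \<longrightarrow> finite (str2 F U1 U2)) \<and>
    (\<forall>U1 U2 V1 V2 \<sigma>1 \<sigma>2. finite U1 \<and> finite U2 \<and> bij_betw \<sigma>1 U1 V1 \<and> bij_betw \<sigma>2 U2 V2 \<longrightarrow>
       bij_betw (trans2 F U1 U2 \<sigma>1 \<sigma>2) (str2 F U1 U2) (str2 F V1 V2)) \<and>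
    (\<forall>U1 U2 \<sigma>1 \<sigma>2 s. finite U1 \<and> finite U2 \<and> s \<in> str2 F U1 U2 \<and>
       (\<forall>u\<in>U1. \<sigma>1 u = u) \<and> (\<forall>u\<in>U2. \<sigma>2 u = u) \<longrightarrow>
       trans2 F U1 U2 \<sigma>1 \<sigma>2 s = s) \<and>
    (\<forall>U1 U2 V1 V2 W1 W2 \<sigma>1 \<sigma>2 \<tau>1 \<tau>2 \<rho>1 \<rho>2 s. finite U1 \<and> finite U2 \<and>
       bij_betw \<sigma>1 U1 V1 \<and> bij_betw \<sigma>2 U2 V2 \<and> bij_betw \<tau>1 V1 W1 \<and> bij_betw \<tau>2 V2 W2 \<and>
       (\<forall>u\<in>U1. \<rho>1 u = \<tau>1 (\<sigma>1 u)) \<and> (\<forall>u\<in>U2. \<rho>2 u = \<tau>2 (\<sigma>2 u)) \<and> s \<in> str2 F U1 U2 \<longrightarrow>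
       trans2 F U1 U2 \<rho>1 \<rho>2 s = trans2 F V1 V2 \<tau>1 \<tau>2 (trans2 F U1 U2 \<sigma>1 \<sigma>2 s))"

definition species2_iso :: "('u, 's) species2 \<Rightarrow> ('u, 't) species2 \<Rightarrow> bool"  (infix "\<simeq>\<^sub>2" 50)
  where "F \<simeq>\<^sub>2 G \<longleftrightarrow> is_species2 F \<and> is_species2 G \<and>
    (\<exists>\<phi>.
      (\<forall>U1 U2. finite U1 \<and> finite U2 \<longrightarrow>
         bij_betw (\<phi> U1 U2) (str2 F U1 U2) (str2 G U1 U2)) \<and>
      (\<forall>U1 U2 V1 V2 \<sigma>1 \<sigma>2 s. finite U1 \<and> finite U2 \<and>
         bij_betw \<sigma>1 U1 V1 \<and> bij_betw \<sigma>2 U2 V2 \<and> s \<in> str2 F U1 U2 \<longrightarrow>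
         \<phi> V1 V2 (trans2 F U1 U2 \<sigma>1 \<sigma>2 s) = trans2 G U1 U2 \<sigma>1 \<sigma>2 (\<phi> U1 U2 s)))"


section \<open>Nonempty sets\<close>

definition E_plus :: "('u, 'u set) species1" where
  "E_plus = \<lparr> str1 = (\<lambda>U. if U = {} then {} else {U}), trans1 = (\<lambda>U \<sigma> s. \<sigma> ` s) \<rparr>"


section \<open>Substitution\<close>

text \<open>
  A species must accept the set of blocks of a partition as a set of points.  We therefore
  substitute over a universe which contains its own finite subsets, over arbitrary atoms;
  \<open>node B\<close> is the finite set \<open>B\<close>, seen as a point.
\<close>

datatype 'a hfset = Atom 'a | Node "'a hfset fset"

definition node :: "'a hfset set \<Rightarrow> 'a hfset" where
  "node B = Node (Abs_fset B)"

primrec elems :: "'a hfset \<Rightarrow> 'a hfset set" where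
  "elems (Atom a) = {}"
| "elems (Node A) = fset A"

lemma elems_node [simp]: "finite B \<Longrightarrow> elems (node B) = B"
  by (simp add: node_def Abs_fset_inverse)

definition on_blocks :: "('a hfset \<Rightarrow> 'a hfset) \<Rightarrow> 'a hfset \<Rightarrow> 'a hfset" where
  "on_blocks \<sigma> x = node (\<sigma> ` elems x)"

record ('u, 's, 't1, 't2) subst_structure =
  part1 :: "'u set set"
  part2 :: "'u set set"
  outer :: 's
  inner1 :: "'u set \<Rightarrow> 't1"
  inner2 :: "'u set \<Rightarrow> 't2"

text \<open>
  The species \<open>F(G(X),H(Y))\<close>: partitions of the two sets, an \<open>F\<close>-structure
  on the pair of partitions, and a \<open>G\<close>- or \<open>H\<close>-structure on each block.
  The families of inner structures are extensional functions on the blocks, so that equal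
  families are equal functions.
\<close>

definition trans_inner ::
  "('u, 't) species1 \<Rightarrow> 'u set \<Rightarrow> 'u set set \<Rightarrow> ('u \<Rightarrow> 'u) \<Rightarrow> ('u set \<Rightarrow> 't) \<Rightarrow> 'u set \<Rightarrow> 't" where
  "trans_inner G U P \<sigma> f =
    (\<lambda>C \<in> image \<sigma> ` P. let B = {u \<in> U. \<sigma> u \<in> C} in trans1 G B \<sigma> (f B))"

definition subst2 ::
  "('a hfset, 's) species2 \<Rightarrow> ('a hfset, 't1) species1 \<Rightarrow> ('a hfset, 't2) species1 \<Rightarrow>
     ('a hfset, ('a hfset, 's, 't1, 't2) subst_structure) species2" where
  "subst2 F G H = \<lparr>
    str2 = (\<lambda>U1 U2. {s.
      partition_on U1 (part1 s) \<and> partition_on U2 (part2 s) \<and>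
      outer s \<in> str2 F (node ` part1 s) (node ` part2 s) \<and>
      inner1 s \<in> (\<Pi>\<^sub>E B\<in>part1 s. str1 G B) \<and>
      inner2 s \<in> (\<Pi>\<^sub>E B\<in>part2 s. str1 H B)}),
    trans2 = (\<lambda>U1 U2 \<sigma>1 \<sigma>2 s. \<lparr>
      part1 = image \<sigma>1 ` part1 s,
      part2 = image \<sigma>2 ` part2 s,
      outer = trans2 F (node ` part1 s) (node ` part2 s) (on_blocks \<sigma>1) (on_blocks \<sigma>2) (outer s),
      inner1 = trans_inner G U1 (part1 s) \<sigma>1 (inner1 s),
      inner2 = trans_inner H U2 (part2 s) \<sigma>2 (inner2 s) \<rparr>) \<rparr>"


section \<open>Bicolored graphs\<close>

text \<open>
  The color is part of the name of a vertex, so that the sets of white and of black labels need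
  not be disjoint.
\<close>

datatype ('w, 'b) vertex = is_white: White 'w | is_black: Black 'b

abbreviation same_color :: "('w, 'b) vertex \<Rightarrow> ('w, 'b) vertex \<Rightarrow> bool" where
  "same_color x y \<equiv> is_white x = is_white y"

record ('w, 'b) colored_graph =
  verts :: "('w, 'b) vertex set"
  edges :: "('w, 'b) vertex set set"

definition simple_graph :: "('w, 'b) colored_graph \<Rightarrow> bool" where
  "simple_graph g \<longleftrightarrow> (\<forall>e \<in> edges g. e \<subseteq> verts g \<and> card e = 2)"

definition adjacent :: "('w, 'b) colored_graph \<Rightarrow> ('w, 'b) vertex \<Rightarrow> ('w, 'b) vertex \<Rightarrow> bool" where
  "adjacent g x y \<longleftrightarrow> {x, y} \<in> edges g"

definition bicolored_graph :: "('w, 'b) colored_graph \<Rightarrow> bool" where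
  "bicolored_graph g \<longleftrightarrow> finite (verts g) \<and> simple_graph g \<and>
    (\<forall>x\<in>verts g. \<forall>y\<in>verts g. adjacent g x y \<longrightarrow> \<not> same_color x y)"

definition white_set :: "('w, 'b) colored_graph \<Rightarrow> 'w set" where
  "white_set g = {u. White u \<in> verts g}"

definition black_set :: "('w, 'b) colored_graph \<Rightarrow> 'b set" where
  "black_set g = {u. Black u \<in> verts g}"

definition neighborhood :: "('w, 'b) colored_graph \<Rightarrow> ('w, 'b) vertex \<Rightarrow> ('w, 'b) vertex set" where
  "neighborhood g x = {y \<in> verts g. adjacent g x y}"

definition semi_point_determining :: "('w, 'b) colored_graph \<Rightarrow> bool" where
  "semi_point_determining g \<longleftrightarrow>
    (\<forall>x\<in>verts g. \<forall>y\<in>verts g. same_color x y \<and> x \<noteq> y \<longrightarrow> neighborhood g x \<noteq> neighborhood g y)"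

definition relabel ::
  "('w \<Rightarrow> 'w2) \<Rightarrow> ('b \<Rightarrow> 'b2) \<Rightarrow> ('w, 'b) colored_graph \<Rightarrow> ('w2, 'b2) colored_graph" where
  "relabel \<sigma>1 \<sigma>2 g =
    \<lparr> verts = map_vertex \<sigma>1 \<sigma>2 ` verts g, edges = image (map_vertex \<sigma>1 \<sigma>2) ` edges g \<rparr>"

definition bicolored_graphs :: "('u, ('u, 'u) colored_graph) species2" where
  "bicolored_graphs = \<lparr>
    str2 = (\<lambda>U1 U2. {g. bicolored_graph g \<and> white_set g = U1 \<and> black_set g = U2}),
    trans2 = (\<lambda>U1 U2. relabel) \<rparr>"

definition spd_bicolored_graphs :: "('u, ('u, 'u) colored_graph) species2" where
  "spd_bicolored_graphs = \<lparr>
    str2 = (\<lambda>U1 U2. {g. bicolored_graph g \<and> semi_point_determining g \<and>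
                        white_set g = U1 \<and> black_set g = U2}),
    trans2 = (\<lambda>U1 U2. relabel) \<rparr>"

section \<open>Functoriality\<close>

lemma is_species1I:
  assumes fin: "\<And>U. finite U \<Longrightarrow> finite (str1 F U)"
    and maps: "\<And>U V \<sigma> s. finite U \<Longrightarrow> bij_betw \<sigma> U V \<Longrightarrow> s \<in> str1 F U \<Longrightarrow> trans1 F U \<sigma> s \<in> str1 F V"
    and ident: "\<And>U \<sigma> s. finite U \<Longrightarrow> s \<in> str1 F U \<Longrightarrow> \<forall>u\<in>U. \<sigma> u = u \<Longrightarrow> trans1 F U \<sigma> s = s"
    and comp: "\<And>U V W \<sigma> \<tau> \<rho> s. finite U \<Longrightarrow> bij_betw \<sigma> U V \<Longrightarrow> bij_betw \<tau> V W \<Longrightarrow>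
       \<forall>u\<in>U. \<rho> u = \<tau> (\<sigma> u) \<Longrightarrow> s \<in> str1 F U \<Longrightarrow>
       trans1 F U \<rho> s = trans1 F V \<tau> (trans1 F U \<sigma> s)"
  shows "is_species1 F"
proof -
  have "bij_betw (trans1 F U \<sigma>) (str1 F U) (str1 F V)" if U: "finite U" and b: "bij_betw \<sigma> U V" for U V \<sigma>
  proof -
    let ?t = "inv_into U \<sigma>"
    have V: "finite V" using U b bij_betw_finite by blast
    have bt: "bij_betw ?t V U" by (rule bij_betw_inv_into[OF b])
    have 1: "trans1 F V ?t (trans1 F U \<sigma> s) = s" if "s \<in> str1 F U" for s
      using comp[OF U b bt, of id s] ident[OF U that, of id] that bij_betw_inv_into_left[OF b] by simp
    have 2: "trans1 F U \<sigma> (trans1 F V ?t s) = s" if "s \<in> str1 F V" for s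
      using comp[OF V bt b, of id s] ident[OF V that, of id] that bij_betw_inv_into_right[OF b] by simp
    show ?thesis
      by (rule bij_betw_byWitness[where f' = "trans1 F V ?t"]) (use 1 2 maps[OF U b] maps[OF V bt] in auto)
  qed
  then show ?thesis unfolding is_species1_def
    apply (intro conjI allI impI)
    subgoal using fin by blast
    subgoal by blast
    subgoal using ident by blast
    subgoal for U V W \<sigma> \<tau> \<rho> s using comp[of U \<sigma> V \<tau> W \<rho> s] by blast
    done
qed

lemma is_species2I:
  assumes fin: "\<And>U1 U2. finite U1 \<Longrightarrow> finite U2 \<Longrightarrow> finite (str2 F U1 U2)"
    and maps: "\<And>U1 U2 V1 V2 \<sigma>1 \<sigma>2 s. finite U1 \<Longrightarrow> finite U2 \<Longrightarrow> bij_betw \<sigma>1 U1 V1 \<Longrightarrow> bij_betw \<sigma>2 U2 V2 \<Longrightarrow>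
       s \<in> str2 F U1 U2 \<Longrightarrow> trans2 F U1 U2 \<sigma>1 \<sigma>2 s \<in> str2 F V1 V2"
    and ident: "\<And>U1 U2 \<sigma>1 \<sigma>2 s. finite U1 \<Longrightarrow> finite U2 \<Longrightarrow> s \<in> str2 F U1 U2 \<Longrightarrow>
       \<forall>u\<in>U1. \<sigma>1 u = u \<Longrightarrow> \<forall>u\<in>U2. \<sigma>2 u = u \<Longrightarrow> trans2 F U1 U2 \<sigma>1 \<sigma>2 s = s"
    and comp: "\<And>U1 U2 V1 V2 W1 W2 \<sigma>1 \<sigma>2 \<tau>1 \<tau>2 \<rho>1 \<rho>2 s. finite U1 \<Longrightarrow> finite U2 \<Longrightarrow>
       bij_betw \<sigma>1 U1 V1 \<Longrightarrow> bij_betw \<sigma>2 U2 V2 \<Longrightarrow> bij_betw \<tau>1 V1 W1 \<Longrightarrow> bij_betw \<tau>2 V2 W2 \<Longrightarrow>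
       \<forall>u\<in>U1. \<rho>1 u = \<tau>1 (\<sigma>1 u) \<Longrightarrow> \<forall>u\<in>U2. \<rho>2 u = \<tau>2 (\<sigma>2 u) \<Longrightarrow> s \<in> str2 F U1 U2 \<Longrightarrow>
       trans2 F U1 U2 \<rho>1 \<rho>2 s = trans2 F V1 V2 \<tau>1 \<tau>2 (trans2 F U1 U2 \<sigma>1 \<sigma>2 s)"
  shows "is_species2 F"
proof -
  have bij: "bij_betw (trans2 F U1 U2 \<sigma>1 \<sigma>2) (str2 F U1 U2) (str2 F V1 V2)"
    if U: "finite U1" "finite U2" and b: "bij_betw \<sigma>1 U1 V1" "bij_betw \<sigma>2 U2 V2" for U1 U2 V1 V2 \<sigma>1 \<sigma>2
  proof -
    let ?t1 = "inv_into U1 \<sigma>1" and ?t2 = "inv_into U2 \<sigma>2"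
    have V: "finite V1" "finite V2" using U b bij_betw_finite by blast+
    have bt: "bij_betw ?t1 V1 U1" "bij_betw ?t2 V2 U2" using b by (simp_all add: bij_betw_inv_into)
    have 1: "trans2 F V1 V2 ?t1 ?t2 (trans2 F U1 U2 \<sigma>1 \<sigma>2 s) = s" if "s \<in> str2 F U1 U2" for s
      using comp[OF U b bt, of id id s] ident[OF U that, of id id] that
        bij_betw_inv_into_left[OF b(1)] bij_betw_inv_into_left[OF b(2)] by simp
    have 2: "trans2 F U1 U2 \<sigma>1 \<sigma>2 (trans2 F V1 V2 ?t1 ?t2 s) = s" if "s \<in> str2 F V1 V2" for s
      using comp[OF V bt b, of id id s] ident[OF V that, of id id] that
        bij_betw_inv_into_right[OF b(1)] bij_betw_inv_into_right[OF b(2)] by simp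
    show ?thesis
      by (rule bij_betw_byWitness[where f' = "trans2 F V1 V2 ?t1 ?t2"])
         (use 1 2 maps[OF U b] maps[OF V bt] in auto)
  qed
  show ?thesis unfolding is_species2_def
    apply (intro conjI allI impI)
    subgoal using fin by simp
    subgoal using bij by simp
    subgoal using ident by simp
    subgoal for U1 U2 V1 V2 W1 W2 \<sigma>1 \<sigma>2 \<tau>1 \<tau>2 \<rho>1 \<rho>2 s
      using comp[of U1 U2 \<sigma>1 V1 \<sigma>2 V2 \<tau>1 W1 \<tau>2 W2 \<rho>1 \<rho>2 s] by simp
    done
qed

lemma is_species1_E_plus: "is_species1 E_plus"
proof (rule is_species1I)
  fix U V W :: "'a set" and \<sigma> \<tau> \<rho> :: "'a \<Rightarrow> 'a" and s
  assume "\<forall>u\<in>U. \<rho> u = \<tau> (\<sigma> u)" "s \<in> str1 E_plus U"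
  then show "trans1 E_plus U \<rho> s = trans1 E_plus V \<tau> (trans1 E_plus U \<sigma> s)"
    by (auto simp: E_plus_def image_image split: if_splits)
next
  fix U V :: "'a set" and \<sigma> s
  assume "bij_betw \<sigma> U V" "s \<in> str1 E_plus U"
  then show "trans1 E_plus U \<sigma> s \<in> str1 E_plus V"
    by (auto simp: E_plus_def bij_betw_def split: if_splits)
next
  fix U :: "'a set" and \<sigma> s
  assume "s \<in> str1 E_plus U" "\<forall>u\<in>U. \<sigma> u = u"
  then show "trans1 E_plus U \<sigma> s = s"
    by (force simp: E_plus_def split: if_splits)
qed (simp add: E_plus_def)

lemma verts_eq: "white_set g = U1 \<Longrightarrow> black_set g = U2 \<Longrightarrow> verts g = White ` U1 \<union> Black ` U2"
  unfolding white_set_def black_set_def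
  apply (rule set_eqI) subgoal for x by (cases x) auto done

lemma edge_subset: "bicolored_graph g \<Longrightarrow> e \<in> edges g \<Longrightarrow> e \<subseteq> verts g"
  by (simp add: bicolored_graph_def simple_graph_def)

lemma relabel_ident:
  assumes "bicolored_graph g" "\<forall>u\<in>white_set g. \<sigma>1 u = u" "\<forall>u\<in>black_set g. \<sigma>2 u = u"
  shows "relabel \<sigma>1 \<sigma>2 g = g"
proof -
  have m: "map_vertex \<sigma>1 \<sigma>2 x = x" if "x \<in> verts g" for x
    using that assms by (cases x) (auto simp: white_set_def black_set_def)
  have "image (map_vertex \<sigma>1 \<sigma>2) e = e" if "e \<in> edges g" for e
  proof -
    have "map_vertex \<sigma>1 \<sigma>2 x = id x" if "x \<in> e" for x
      using m edge_subset[OF assms(1) \<open>e \<in> edges g\<close>] that by auto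
    then show ?thesis by (metis image_cong image_id id_apply)
  qed
  then show ?thesis using m by (cases g) (auto simp: relabel_def)
qed

lemma relabel_comp:
  assumes "bicolored_graph g" "\<forall>u\<in>white_set g. \<rho>1 u = \<tau>1 (\<sigma>1 u)" "\<forall>u\<in>black_set g. \<rho>2 u = \<tau>2 (\<sigma>2 u)"
  shows "relabel \<rho>1 \<rho>2 g = relabel \<tau>1 \<tau>2 (relabel \<sigma>1 \<sigma>2 g)"
proof -
  have m: "map_vertex \<rho>1 \<rho>2 x = map_vertex \<tau>1 \<tau>2 (map_vertex \<sigma>1 \<sigma>2 x)" if "x \<in> verts g" for x
    using that assms by (cases x) (auto simp: white_set_def black_set_def)
  have "image (map_vertex \<rho>1 \<rho>2) e = image (map_vertex \<tau>1 \<tau>2) (image (map_vertex \<sigma>1 \<sigma>2) e)" if "e \<in> edges g" for e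
    unfolding image_image using m edge_subset[OF assms(1) that] by (intro image_cong) auto
  then show ?thesis using m by (auto simp: relabel_def image_image intro!: image_cong)
qed

lemma relabel_maps:
  assumes g: "bicolored_graph g" and s1: "bij_betw \<sigma>1 (white_set g) V1" and s2: "bij_betw \<sigma>2 (black_set g) V2"
  shows "bicolored_graph (relabel \<sigma>1 \<sigma>2 g)"
    and "white_set (relabel \<sigma>1 \<sigma>2 g) = V1" and "black_set (relabel \<sigma>1 \<sigma>2 g) = V2"
    and "semi_point_determining g \<Longrightarrow> semi_point_determining (relabel \<sigma>1 \<sigma>2 g)"
proof -
  let ?m = "map_vertex \<sigma>1 \<sigma>2"
  note v = verts_eq[OF refl refl, of g]
  have inj: "inj_on ?m (verts g)"
  proof (rule inj_onI)
    fix x y assume "x \<in> verts g" "y \<in> verts g" "?m x = ?m y"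
    moreover have "inj_on \<sigma>1 (white_set g)" "inj_on \<sigma>2 (black_set g)" using s1 s2 by (simp_all add: bij_betw_def)
    ultimately show "x = y" by (cases x; cases y) (simp_all add: inj_on_def white_set_def black_set_def)
  qed
  have col: "is_white (?m x) = is_white x" for x by (cases x) auto
  have adj: "adjacent (relabel \<sigma>1 \<sigma>2 g) (?m x) (?m y) \<longleftrightarrow> adjacent g x y"
    if "x \<in> verts g" "y \<in> verts g" for x y
  proof -
    have "{?m x, ?m y} \<in> image ?m ` edges g \<longleftrightarrow> {x,y} \<in> edges g" (is "?L = ?R")
    proof
      assume ?L
      then obtain e where e: "e \<in> edges g" "?m ` {x,y} = ?m ` e" by auto
      then have "{x,y} = e" using inj_on_image_eq_iff[OF inj, of "{x,y}" e] edge_subset[OF g e(1)] that by simp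
      then show ?R using e by simp
    next
      assume ?R
      then have "?m ` {x,y} \<in> image ?m ` edges g" by blast
      then show ?L by simp
    qed
    then show ?thesis by (simp add: adjacent_def relabel_def)
  qed
  have vr: "verts (relabel \<sigma>1 \<sigma>2 g) = ?m ` verts g" by (simp add: relabel_def)
  have "card (?m ` e) = card e" if "e \<in> edges g" for e
    using inj_on_subset[OF inj edge_subset[OF g that]] by (rule card_image)
  then have "simple_graph (relabel \<sigma>1 \<sigma>2 g)"
    using g by (auto simp: bicolored_graph_def simple_graph_def relabel_def)
  moreover have "\<not> same_color x' y'"
    if xy: "x' \<in> ?m ` verts g" "y' \<in> ?m ` verts g" "adjacent (relabel \<sigma>1 \<sigma>2 g) x' y'" for x' y'
  proof -
    obtain x y where x: "x \<in> verts g" "x' = ?m x" and y: "y \<in> verts g" "y' = ?m y" using xy by blast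
    then have "adjacent g x y" using adj xy(3) by simp
    then have "\<not> same_color x y" using g x y unfolding bicolored_graph_def by blast
    then show ?thesis by (simp add: x y col)
  qed
  moreover have "finite (verts g)" using g by (simp add: bicolored_graph_def)
  ultimately show "bicolored_graph (relabel \<sigma>1 \<sigma>2 g)" unfolding bicolored_graph_def vr by simp
  have mW: "White x = ?m y \<longleftrightarrow> (\<exists>w. y = White w \<and> x = \<sigma>1 w)" for x y by (cases y) auto
  have mB: "Black x = ?m y \<longleftrightarrow> (\<exists>w. y = Black w \<and> x = \<sigma>2 w)" for x y by (cases y) auto
  have "white_set (relabel \<sigma>1 \<sigma>2 g) = \<sigma>1 ` white_set g"
    by (rule set_eqI) (auto simp: white_set_def vr image_iff mW)
  moreover have "black_set (relabel \<sigma>1 \<sigma>2 g) = \<sigma>2 ` black_set g"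
    by (rule set_eqI) (auto simp: black_set_def vr image_iff mB)
  ultimately show "white_set (relabel \<sigma>1 \<sigma>2 g) = V1" "black_set (relabel \<sigma>1 \<sigma>2 g) = V2"
    using s1 s2 by (auto simp: bij_betw_def)
  have nb: "neighborhood (relabel \<sigma>1 \<sigma>2 g) (?m x) = ?m ` neighborhood g x" if "x \<in> verts g" for x
  proof
    show "neighborhood (relabel \<sigma>1 \<sigma>2 g) (?m x) \<subseteq> ?m ` neighborhood g x"
    proof
      fix z assume "z \<in> neighborhood (relabel \<sigma>1 \<sigma>2 g) (?m x)"
      then obtain y where "y \<in> verts g" "z = ?m y" "adjacent (relabel \<sigma>1 \<sigma>2 g) (?m x) (?m y)"
        unfolding neighborhood_def vr by blast
      then show "z \<in> ?m ` neighborhood g x" using adj[OF that] unfolding neighborhood_def by blast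
    qed
    show "?m ` neighborhood g x \<subseteq> neighborhood (relabel \<sigma>1 \<sigma>2 g) (?m x)"
      using adj[OF that] unfolding neighborhood_def vr by blast
  qed
  show "semi_point_determining (relabel \<sigma>1 \<sigma>2 g)" if "semi_point_determining g"
  proof -
    have nbinj: "neighborhood g x = neighborhood g y"
      if "x \<in> verts g" "y \<in> verts g" "?m ` neighborhood g x = ?m ` neighborhood g y" for x y
      using that inj_on_image_eq_iff[OF inj, of "neighborhood g x" "neighborhood g y"] by (auto simp: neighborhood_def)
    show ?thesis unfolding semi_point_determining_def vr
    proof (intro ballI impI)
      fix x' y' assume "x' \<in> ?m ` verts g" "y' \<in> ?m ` verts g" and c: "same_color x' y' \<and> x' \<noteq> y'"
      then obtain x y where x: "x \<in> verts g" "x' = ?m x" and y: "y \<in> verts g" "y' = ?m y" by blast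
      have "neighborhood g x \<noteq> neighborhood g y"
        using that x y c unfolding semi_point_determining_def by (metis col)
      then show "neighborhood (relabel \<sigma>1 \<sigma>2 g) x' \<noteq> neighborhood (relabel \<sigma>1 \<sigma>2 g) y'"
        using nbinj[OF x(1) y(1)] nb[OF x(1)] nb[OF y(1)] x(2) y(2) by auto
    qed
  qed
qed

lemma finite_graphs: 
  assumes "finite U1" "finite U2" shows "finite {g. bicolored_graph g \<and> white_set g = U1 \<and> black_set g = U2}"
proof -
  let ?V = "White ` U1 \<union> Black ` U2"
  have "{g. bicolored_graph g \<and> white_set g = U1 \<and> black_set g = U2} \<subseteq> (\<lambda>E. \<lparr>verts = ?V, edges = E\<rparr>) ` Pow (Pow ?V)"
  proof (rule subsetI)
    fix g assume "g \<in> {g. bicolored_graph g \<and> white_set g = U1 \<and> black_set g = U2}"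
    then have g: "bicolored_graph g" "verts g = ?V" using verts_eq[of g U1 U2] by simp_all
    then have "edges g \<in> Pow (Pow ?V)" using edge_subset by blast
    then show "g \<in> (\<lambda>E. \<lparr>verts = ?V, edges = E\<rparr>) ` Pow (Pow ?V)" using g by (intro image_eqI[of _ _ "edges g"]) auto
  qed
  then show ?thesis by (rule finite_subset) (use assms in auto)
qed

lemma is_species2_bicolored_graphs: "is_species2 bicolored_graphs"
proof (rule is_species2I)
  fix U1 U2 V1 V2 :: "'a set" and \<sigma>1 \<sigma>2 s
  assume "bij_betw \<sigma>1 U1 V1" "bij_betw \<sigma>2 U2 V2" "s \<in> str2 bicolored_graphs U1 U2"
  then show "trans2 bicolored_graphs U1 U2 \<sigma>1 \<sigma>2 s \<in> str2 bicolored_graphs V1 V2"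
    using relabel_maps[of s \<sigma>1 V1 \<sigma>2 V2] by (simp add: bicolored_graphs_def)
next
  fix U1 U2 :: "'a set" and \<sigma>1 \<sigma>2 s
  assume "s \<in> str2 bicolored_graphs U1 U2" "\<forall>u\<in>U1. \<sigma>1 u = u" "\<forall>u\<in>U2. \<sigma>2 u = u"
  then show "trans2 bicolored_graphs U1 U2 \<sigma>1 \<sigma>2 s = s"
    using relabel_ident[of s \<sigma>1 \<sigma>2] by (simp add: bicolored_graphs_def)
next
  fix U1 U2 V1 V2 :: "'a set" and \<sigma>1 \<sigma>2 \<tau>1 \<tau>2 \<rho>1 \<rho>2 :: "'a \<Rightarrow> 'a" and s
  assume "\<forall>u\<in>U1. \<rho>1 u = \<tau>1 (\<sigma>1 u)" "\<forall>u\<in>U2. \<rho>2 u = \<tau>2 (\<sigma>2 u)" "s \<in> str2 bicolored_graphs U1 U2"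
  then show "trans2 bicolored_graphs U1 U2 \<rho>1 \<rho>2 s = trans2 bicolored_graphs V1 V2 \<tau>1 \<tau>2 (trans2 bicolored_graphs U1 U2 \<sigma>1 \<sigma>2 s)"
    using relabel_comp[of s \<rho>1 \<tau>1 \<sigma>1 \<rho>2 \<tau>2 \<sigma>2] by (simp add: bicolored_graphs_def)
next
  fix U1 U2 :: "'a set" assume "finite U1" "finite U2"
  then show "finite (str2 bicolored_graphs U1 U2)"
    by (rule finite_subset[OF _ finite_graphs, rotated]) (auto simp: bicolored_graphs_def)
qed

lemma is_species2_spd: "is_species2 spd_bicolored_graphs"
proof (rule is_species2I)
  fix U1 U2 V1 V2 :: "'a set" and \<sigma>1 \<sigma>2 s
  assume "bij_betw \<sigma>1 U1 V1" "bij_betw \<sigma>2 U2 V2" "s \<in> str2 spd_bicolored_graphs U1 U2"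
  then show "trans2 spd_bicolored_graphs U1 U2 \<sigma>1 \<sigma>2 s \<in> str2 spd_bicolored_graphs V1 V2"
    using relabel_maps[of s \<sigma>1 V1 \<sigma>2 V2] by (simp add: spd_bicolored_graphs_def)
next
  fix U1 U2 :: "'a set" and \<sigma>1 \<sigma>2 s
  assume "s \<in> str2 spd_bicolored_graphs U1 U2" "\<forall>u\<in>U1. \<sigma>1 u = u" "\<forall>u\<in>U2. \<sigma>2 u = u"
  then show "trans2 spd_bicolored_graphs U1 U2 \<sigma>1 \<sigma>2 s = s"
    using relabel_ident[of s \<sigma>1 \<sigma>2] by (simp add: spd_bicolored_graphs_def)
next
  fix U1 U2 V1 V2 :: "'a set" and \<sigma>1 \<sigma>2 \<tau>1 \<tau>2 \<rho>1 \<rho>2 :: "'a \<Rightarrow> 'a" and s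
  assume "\<forall>u\<in>U1. \<rho>1 u = \<tau>1 (\<sigma>1 u)" "\<forall>u\<in>U2. \<rho>2 u = \<tau>2 (\<sigma>2 u)" "s \<in> str2 spd_bicolored_graphs U1 U2"
  then show "trans2 spd_bicolored_graphs U1 U2 \<rho>1 \<rho>2 s = trans2 spd_bicolored_graphs V1 V2 \<tau>1 \<tau>2 (trans2 spd_bicolored_graphs U1 U2 \<sigma>1 \<sigma>2 s)"
    using relabel_comp[of s \<rho>1 \<tau>1 \<sigma>1 \<rho>2 \<tau>2 \<sigma>2] by (simp add: spd_bicolored_graphs_def)
next
  fix U1 U2 :: "'a set" assume "finite U1" "finite U2"
  then show "finite (str2 spd_bicolored_graphs U1 U2)"
    by (rule finite_subset[OF _ finite_graphs, rotated]) (auto simp: spd_bicolored_graphs_def)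
qed

lemma is_species1D:
  assumes "is_species1 F" "finite U"
  shows "finite (str1 F U)"
    and "\<And>V \<sigma> s. bij_betw \<sigma> U V \<Longrightarrow> s \<in> str1 F U \<Longrightarrow> trans1 F U \<sigma> s \<in> str1 F V"
    and "\<And>\<sigma> s. s \<in> str1 F U \<Longrightarrow> \<forall>u\<in>U. \<sigma> u = u \<Longrightarrow> trans1 F U \<sigma> s = s"
    and "\<And>V W \<sigma> \<tau> \<rho> s. bij_betw \<sigma> U V \<Longrightarrow> bij_betw \<tau> V W \<Longrightarrow>
       \<forall>u\<in>U. \<rho> u = \<tau> (\<sigma> u) \<Longrightarrow> s \<in> str1 F U \<Longrightarrow>
       trans1 F U \<rho> s = trans1 F V \<tau> (trans1 F U \<sigma> s)"
proof -
  note d = assms(1)[unfolded is_species1_def]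
  show "finite (str1 F U)" using d[THEN conjunct1] assms(2) by simp
  show "trans1 F U \<sigma> s \<in> str1 F V" if "bij_betw \<sigma> U V" "s \<in> str1 F U" for V \<sigma> s
    using d[THEN conjunct2, THEN conjunct1, rule_format, of U \<sigma> V] assms(2) that by (auto dest: bij_betwE)
  show "trans1 F U \<sigma> s = s" if "s \<in> str1 F U" "\<forall>u\<in>U. \<sigma> u = u" for \<sigma> s
    using d[THEN conjunct2, THEN conjunct2, THEN conjunct1, rule_format, of U s \<sigma>] assms(2) that by simp
  show "trans1 F U \<rho> s = trans1 F V \<tau> (trans1 F U \<sigma> s)"
    if "bij_betw \<sigma> U V" "bij_betw \<tau> V W" "\<forall>u\<in>U. \<rho> u = \<tau> (\<sigma> u)" "s \<in> str1 F U" for V W \<sigma> \<tau> \<rho> s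
    using d[THEN conjunct2, THEN conjunct2, THEN conjunct2, rule_format, of U \<sigma> V \<tau> W \<rho> s] assms(2) that by simp
qed

lemma is_species2D:
  assumes "is_species2 F" "finite U1" "finite U2"
  shows "finite (str2 F U1 U2)"
    and "\<And>V1 V2 \<sigma>1 \<sigma>2 s. bij_betw \<sigma>1 U1 V1 \<Longrightarrow> bij_betw \<sigma>2 U2 V2 \<Longrightarrow>
       s \<in> str2 F U1 U2 \<Longrightarrow> trans2 F U1 U2 \<sigma>1 \<sigma>2 s \<in> str2 F V1 V2"
    and "\<And>\<sigma>1 \<sigma>2 s. s \<in> str2 F U1 U2 \<Longrightarrow> \<forall>u\<in>U1. \<sigma>1 u = u \<Longrightarrow> \<forall>u\<in>U2. \<sigma>2 u = u \<Longrightarrow>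
       trans2 F U1 U2 \<sigma>1 \<sigma>2 s = s"
    and "\<And>V1 V2 W1 W2 \<sigma>1 \<sigma>2 \<tau>1 \<tau>2 \<rho>1 \<rho>2 s.
       bij_betw \<sigma>1 U1 V1 \<Longrightarrow> bij_betw \<sigma>2 U2 V2 \<Longrightarrow> bij_betw \<tau>1 V1 W1 \<Longrightarrow> bij_betw \<tau>2 V2 W2 \<Longrightarrow>
       \<forall>u\<in>U1. \<rho>1 u = \<tau>1 (\<sigma>1 u) \<Longrightarrow> \<forall>u\<in>U2. \<rho>2 u = \<tau>2 (\<sigma>2 u) \<Longrightarrow> s \<in> str2 F U1 U2 \<Longrightarrow>
       trans2 F U1 U2 \<rho>1 \<rho>2 s = trans2 F V1 V2 \<tau>1 \<tau>2 (trans2 F U1 U2 \<sigma>1 \<sigma>2 s)"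
proof -
  note d = assms(1)[unfolded is_species2_def]
  show "finite (str2 F U1 U2)" using d[THEN conjunct1] assms(2,3) by simp
  show "trans2 F U1 U2 \<sigma>1 \<sigma>2 s \<in> str2 F V1 V2"
    if "bij_betw \<sigma>1 U1 V1" "bij_betw \<sigma>2 U2 V2" "s \<in> str2 F U1 U2" for V1 V2 \<sigma>1 \<sigma>2 s
    using d[THEN conjunct2, THEN conjunct1, rule_format, of U1 U2 \<sigma>1 V1 \<sigma>2 V2] assms(2,3) that by (auto dest: bij_betwE)
  show "trans2 F U1 U2 \<sigma>1 \<sigma>2 s = s"
    if "s \<in> str2 F U1 U2" "\<forall>u\<in>U1. \<sigma>1 u = u" "\<forall>u\<in>U2. \<sigma>2 u = u" for \<sigma>1 \<sigma>2 s
    using d[THEN conjunct2, THEN conjunct2, THEN conjunct1, rule_format, of U1 U2 s \<sigma>1 \<sigma>2] assms(2,3) that by simp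
  show "trans2 F U1 U2 \<rho>1 \<rho>2 s = trans2 F V1 V2 \<tau>1 \<tau>2 (trans2 F U1 U2 \<sigma>1 \<sigma>2 s)"
    if "bij_betw \<sigma>1 U1 V1" "bij_betw \<sigma>2 U2 V2" "bij_betw \<tau>1 V1 W1" "bij_betw \<tau>2 V2 W2"
      "\<forall>u\<in>U1. \<rho>1 u = \<tau>1 (\<sigma>1 u)" "\<forall>u\<in>U2. \<rho>2 u = \<tau>2 (\<sigma>2 u)" "s \<in> str2 F U1 U2"
    for V1 V2 W1 W2 \<sigma>1 \<sigma>2 \<tau>1 \<tau>2 \<rho>1 \<rho>2 s
    using d[THEN conjunct2, THEN conjunct2, THEN conjunct2,
      rule_format, of U1 U2 \<sigma>1 V1 \<sigma>2 V2 \<tau>1 W1 \<tau>2 W2 \<rho>1 \<rho>2 s] assms(2,3) that by simp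
qed

context
  fixes U :: "'u set" and P
  assumes P: "partition_on U P" and U: "finite U"
begin

lemma blk: "B \<in> P \<Longrightarrow> B \<subseteq> U" using P by (auto simp: partition_on_def)
lemma blk_fin: "B \<in> P \<Longrightarrow> finite B" using blk U finite_subset by blast
lemma part_fin: "finite P" using U P by (rule finite_elements)

lemma blk_preimage: assumes "inj_on \<sigma> U" "B \<in> P" shows "{u \<in> U. \<sigma> u \<in> \<sigma> ` B} = B"
  using assms blk[of B] by (auto simp: inj_on_def)

lemma blk_bij: "inj_on \<sigma> U \<Longrightarrow> B \<in> P \<Longrightarrow> bij_betw \<sigma> B (\<sigma> ` B)"
  using blk[of B] by (auto simp: bij_betw_def intro: inj_on_subset)

lemma part_image: assumes "bij_betw \<sigma> U V" shows "partition_on V (image \<sigma> ` P)"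
proof -
  have i: "inj_on \<sigma> U" and V: "V = \<sigma> ` U" using assms by (auto simp: bij_betw_def)
  have "partition_on (\<sigma> ` U) ((`) \<sigma> ` P - {{}})"
    by (rule partition_on_inj_image[OF P i])
  moreover have "(`) \<sigma> ` P - {{}} = (`) \<sigma> ` P" using P by (auto simp: partition_on_def)
  ultimately show ?thesis using V by simp
qed

lemma trans_inner_val: "inj_on \<sigma> U \<Longrightarrow> B \<in> P \<Longrightarrow> trans_inner G U P \<sigma> f (\<sigma> ` B) = trans1 G B \<sigma> (f B)"
  by (simp add: trans_inner_def blk_preimage)

lemma trans_inner_maps:
  assumes "is_species1 G" "inj_on \<sigma> U" "f \<in> (\<Pi>\<^sub>E B\<in>P. str1 G B)"
  shows "trans_inner G U P \<sigma> f \<in> (\<Pi>\<^sub>E C\<in>image \<sigma> ` P. str1 G C)"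
proof (rule PiE_I)
  fix C assume "C \<in> image \<sigma> ` P"
  then obtain B where "B \<in> P" "C = \<sigma> ` B" by blast
  then show "trans_inner G U P \<sigma> f C \<in> str1 G C"
    using is_species1D(2)[OF assms(1) blk_fin blk_bij[OF assms(2)], of B "f B"] assms(3)
    by (auto simp: trans_inner_val[OF assms(2)])
qed (simp add: trans_inner_def)

lemma trans_inner_ident:
  assumes "is_species1 G" "\<forall>u\<in>U. \<sigma> u = u" "f \<in> (\<Pi>\<^sub>E B\<in>P. str1 G B)"
  shows "image \<sigma> ` P = P" "trans_inner G U P \<sigma> f = f"
proof -
  have i: "inj_on \<sigma> U" using assms(2) by (auto simp: inj_on_def)
  have im: "\<sigma> ` B = B" if "B \<in> P" for B
  proof -
    have "\<forall>u\<in>B. \<sigma> u = u" using blk[OF that] assms(2) by auto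
    then show ?thesis by force
  qed
  then show eq: "image \<sigma> ` P = P" by auto
  show "trans_inner G U P \<sigma> f = f"
  proof (rule PiE_ext)
    show "trans_inner G U P \<sigma> f \<in> (\<Pi>\<^sub>E B\<in>P. str1 G B)" using trans_inner_maps[OF assms(1) i assms(3)] eq by simp
    show "f \<in> (\<Pi>\<^sub>E B\<in>P. str1 G B)" by fact
    fix B assume B: "B \<in> P"
    have "trans1 G B \<sigma> (f B) = f B"
      using is_species1D(3)[OF assms(1) blk_fin[OF B], of "f B" \<sigma>] assms(2,3) B blk[OF B] by auto
    then show "trans_inner G U P \<sigma> f B = f B" using trans_inner_val[OF i B, of G f] im[OF B] by simp
  qed
qed

end

lemma trans_inner_comp:
  assumes P: "partition_on U P" and U: "finite U" and G: "is_species1 G" and f: "f \<in> (\<Pi>\<^sub>E B\<in>P. str1 G B)"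
    and s: "bij_betw \<sigma> U V" and t: "bij_betw \<tau> V W" and r: "\<forall>u\<in>U. \<rho> u = \<tau> (\<sigma> u)"
  shows "image \<rho> ` P = image \<tau> ` image \<sigma> ` P"
    "trans_inner G U P \<rho> f = trans_inner G V (image \<sigma> ` P) \<tau> (trans_inner G U P \<sigma> f)"
proof -
  have V: "finite V" using U s bij_betw_finite by blast
  note Q = part_image[OF P U s]
  have is': "inj_on \<sigma> U" and it: "inj_on \<tau> V" using s t by (auto simp: bij_betw_def)
  have ir: "inj_on \<rho> U"
    using inj_on_cong[of U \<rho> "\<tau> \<circ> \<sigma>"] r bij_betw_trans[OF s t] by (auto simp: bij_betw_def)
  have im: "\<rho> ` B = \<tau> ` \<sigma> ` B" if "B \<in> P" for B
    unfolding image_image using blk[OF P U that] r by (intro image_cong) auto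
  show eq: "image \<rho> ` P = image \<tau> ` image \<sigma> ` P" 
  proof -
    have "image \<rho> ` P = (\<lambda>B. \<tau> ` \<sigma> ` B) ` P" using im by (rule image_cong[OF refl])
    then show ?thesis by (simp add: image_image)
  qed
  show "trans_inner G U P \<rho> f = trans_inner G V (image \<sigma> ` P) \<tau> (trans_inner G U P \<sigma> f)" (is "?l = ?r")
  proof (rule PiE_ext)
    show "?l \<in> (\<Pi>\<^sub>E C\<in>image \<rho> ` P. str1 G C)" by (rule trans_inner_maps[OF P U G ir f])
    show "?r \<in> (\<Pi>\<^sub>E C\<in>image \<rho> ` P. str1 G C)"
      unfolding eq by (rule trans_inner_maps[OF Q V G it trans_inner_maps[OF P U G is' f]])
    fix C assume "C \<in> image \<rho> ` P"
    then obtain B where B: "B \<in> P" "C = \<rho> ` B" by blast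
    have sB: "\<sigma> ` B \<in> image \<sigma> ` P" using B by blast
    have fB: "f B \<in> str1 G B" using f B by auto
    have "?l C = trans1 G B \<rho> (f B)" using B trans_inner_val[OF P U ir] by simp
    also have "\<dots> = trans1 G (\<sigma> ` B) \<tau> (trans1 G B \<sigma> (f B))"
      by (rule is_species1D(4)[OF G blk_fin[OF P U B(1)] blk_bij[OF P U is' B(1)] blk_bij[OF Q V it sB] _ fB])
         (use r blk[OF P U B(1)] in auto)
    also have "\<dots> = ?r C"
      using B im[OF B(1)] trans_inner_val[OF Q V it sB, of G "trans_inner G U P \<sigma> f"] trans_inner_val[OF P U is' B(1), of G f] by simp
    finally show "?l C = ?r C" .
  qed
qed

lemma on_blocks_node: "finite B \<Longrightarrow> on_blocks \<sigma> (node B) = node (\<sigma> ` B)"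
  by (simp add: on_blocks_def)

lemma node_inj: "finite A \<Longrightarrow> finite B \<Longrightarrow> node A = node B \<longleftrightarrow> A = B"
  by (metis elems_node)

lemma on_blocks_bij:
  assumes P: "partition_on U P" and U: "finite U" and s: "bij_betw \<sigma> U V"
  shows "bij_betw (on_blocks \<sigma>) (node ` P) (node ` image \<sigma> ` P)"
proof -
  have i: "inj_on \<sigma> U" using s by (auto simp: bij_betw_def)
  have "inj_on (on_blocks \<sigma>) (node ` P)"
    using blk_fin[OF P U] blk[OF P U] inj_on_image_eq_iff[OF i]
    by (auto simp: inj_on_def[of "on_blocks \<sigma>"] on_blocks_node node_inj)
  moreover have "on_blocks \<sigma> ` node ` P = node ` image \<sigma> ` P"
    unfolding image_image using blk_fin[OF P U] by (intro image_cong) (auto simp: on_blocks_node)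
  ultimately show ?thesis by (simp add: bij_betw_def)
qed

lemma is_species2_subst2:
  assumes F: "is_species2 F" and G: "is_species1 G" and H: "is_species1 H"
  shows "is_species2 (subst2 F G H)"
proof (rule is_species2I)
  fix U1 U2 :: "'a hfset set" assume U: "finite U1" "finite U2"
  let ?S = "SIGMA P : {P. partition_on U1 P}. SIGMA Q : {Q. partition_on U2 Q}.
     str2 F (node ` P) (node ` Q) \<times> (\<Pi>\<^sub>E B\<in>P. str1 G B) \<times> (\<Pi>\<^sub>E B\<in>Q. str1 H B)"
  let ?k = "\<lambda>(P, Q, o', i1, i2). \<lparr>part1 = P, part2 = Q, outer = o', inner1 = i1, inner2 = i2\<rparr>"
  have fp: "finite {P. partition_on V P}" if "finite V" for V :: "'a hfset set"
    by (rule finite_subset[of _ "Pow (Pow V)"]) (use that in \<open>auto simp: partition_on_def\<close>)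
  have "finite ?S"
    by (intro finite_SigmaI fp U finite_cartesian_product finite_PiE is_species2D(1)[OF F] finite_imageI
         is_species1D(1)[OF G] is_species1D(1)[OF H])
       (auto dest: part_fin[OF _ U(1)] part_fin[OF _ U(2)] blk_fin[OF _ U(1)] blk_fin[OF _ U(2)])
  moreover have "str2 (subst2 F G H) U1 U2 \<subseteq> ?k ` ?S"
  proof
    fix s assume "s \<in> str2 (subst2 F G H) U1 U2"
    then show "s \<in> ?k ` ?S"
      by (intro image_eqI[of _ _ "(part1 s, part2 s, outer s, inner1 s, inner2 s)"]) (auto simp: subst2_def)
  qed
  ultimately show "finite (str2 (subst2 F G H) U1 U2)" by (meson finite_imageI finite_subset)
next
  fix U1 U2 V1 V2 :: "'a hfset set" and \<sigma>1 \<sigma>2 s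
  assume U: "finite U1" "finite U2" and b: "bij_betw \<sigma>1 U1 V1" "bij_betw \<sigma>2 U2 V2"
    and s: "s \<in> str2 (subst2 F G H) U1 U2"
  have p: "partition_on U1 (part1 s)" "partition_on U2 (part2 s)" using s by (auto simp: subst2_def)
  have i: "inj_on \<sigma>1 U1" "inj_on \<sigma>2 U2" using b by (auto simp: bij_betw_def)
  show "trans2 (subst2 F G H) U1 U2 \<sigma>1 \<sigma>2 s \<in> str2 (subst2 F G H) V1 V2"
    using s part_image[OF p(1) U(1) b(1)] part_image[OF p(2) U(2) b(2)]
      trans_inner_maps[OF p(1) U(1) G i(1)] trans_inner_maps[OF p(2) U(2) H i(2)]
      is_species2D(2)[OF F _ _ on_blocks_bij[OF p(1) U(1) b(1)] on_blocks_bij[OF p(2) U(2) b(2)]]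
      part_fin[OF p(1) U(1)] part_fin[OF p(2) U(2)]
    by (simp add: subst2_def)
next
  fix U1 U2 :: "'a hfset set" and \<sigma>1 \<sigma>2 s
  assume U: "finite U1" "finite U2" 
    and s: "s \<in> str2 (subst2 F G H) U1 U2" and id: "\<forall>u\<in>U1. \<sigma>1 u = u" "\<forall>u\<in>U2. \<sigma>2 u = u"
  have p: "partition_on U1 (part1 s)" "partition_on U2 (part2 s)"
    and f: "inner1 s \<in> (\<Pi>\<^sub>E B\<in>part1 s. str1 G B)" "inner2 s \<in> (\<Pi>\<^sub>E B\<in>part2 s. str1 H B)"
    and o': "outer s \<in> str2 F (node ` part1 s) (node ` part2 s)" using s by (auto simp: subst2_def)
  have ob: "on_blocks \<sigma> (node B) = node B" if "partition_on U P" "finite U" "B \<in> P" "\<forall>u\<in>U. \<sigma> u = u"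
    for U P B and \<sigma> :: "'a hfset \<Rightarrow> 'a hfset"
  proof -
    have "\<sigma> ` B = id ` B" using blk[OF that(1-3)] that(4) by (intro image_cong) auto
    then show ?thesis using blk_fin[OF that(1-3)] by (simp add: on_blocks_node)
  qed
  have "trans2 F (node ` part1 s) (node ` part2 s) (on_blocks \<sigma>1) (on_blocks \<sigma>2) (outer s) = outer s"
    by (rule is_species2D(3)[OF F _ _ o'])
       (use ob[OF p(1) U(1)] ob[OF p(2) U(2)] id part_fin[OF p(1) U(1)] part_fin[OF p(2) U(2)] in auto)
  then show "trans2 (subst2 F G H) U1 U2 \<sigma>1 \<sigma>2 s = s"
    using trans_inner_ident[OF p(1) U(1) G id(1) f(1)] trans_inner_ident[OF p(2) U(2) H id(2) f(2)]
    by (simp add: subst2_def)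
next
  fix U1 U2 V1 V2 W1 W2 :: "'a hfset set" and \<sigma>1 \<sigma>2 \<tau>1 \<tau>2 \<rho>1 \<rho>2 s
  assume U: "finite U1" "finite U2" and b: "bij_betw \<sigma>1 U1 V1" "bij_betw \<sigma>2 U2 V2"
    and c: "bij_betw \<tau>1 V1 W1" "bij_betw \<tau>2 V2 W2"
    and r: "\<forall>u\<in>U1. \<rho>1 u = \<tau>1 (\<sigma>1 u)" "\<forall>u\<in>U2. \<rho>2 u = \<tau>2 (\<sigma>2 u)"
    and s: "s \<in> str2 (subst2 F G H) U1 U2"
  have p: "partition_on U1 (part1 s)" "partition_on U2 (part2 s)"
    and f: "inner1 s \<in> (\<Pi>\<^sub>E B\<in>part1 s. str1 G B)" "inner2 s \<in> (\<Pi>\<^sub>E B\<in>part2 s. str1 H B)"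
    and o': "outer s \<in> str2 F (node ` part1 s) (node ` part2 s)" using s by (auto simp: subst2_def)
  have V: "finite V1" "finite V2" using U b bij_betw_finite by blast+
  note q = part_image[OF p(1) U(1) b(1)] part_image[OF p(2) U(2) b(2)]
  have ob: "on_blocks \<rho> x = on_blocks \<tau> (on_blocks \<sigma> x)"
    if that: "partition_on U P" "finite U" and x: "x \<in> node ` P" and r: "\<forall>u\<in>U. \<rho> u = \<tau> (\<sigma> u)"
    for U P x and \<rho> \<sigma> \<tau> :: "'a hfset \<Rightarrow> 'a hfset"
  proof -
    obtain B where B: "B \<in> P" "x = node B" using x by blast
    have "\<rho> ` B = \<tau> ` \<sigma> ` B" unfolding image_image using blk[OF that(1,2) B(1)] r by (intro image_cong) auto
    then show ?thesis using blk_fin[OF that(1,2) B(1)] B by (simp add: on_blocks_node)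
  qed
  have "trans2 F (node ` part1 s) (node ` part2 s) (on_blocks \<rho>1) (on_blocks \<rho>2) (outer s) =
     trans2 F (node ` image \<sigma>1 ` part1 s) (node ` image \<sigma>2 ` part2 s) (on_blocks \<tau>1) (on_blocks \<tau>2)
      (trans2 F (node ` part1 s) (node ` part2 s) (on_blocks \<sigma>1) (on_blocks \<sigma>2) (outer s))"
    by (rule is_species2D(4)[OF F _ _ on_blocks_bij[OF p(1) U(1) b(1)] on_blocks_bij[OF p(2) U(2) b(2)]
         on_blocks_bij[OF q(1) V(1) c(1)] on_blocks_bij[OF q(2) V(2) c(2)] _ _ o'])
       (use ob[where \<rho>=\<rho>1 and \<tau>=\<tau>1 and \<sigma>=\<sigma>1, OF p(1) U(1) _ r(1)] ob[where \<rho>=\<rho>2 and \<tau>=\<tau>2 and \<sigma>=\<sigma>2, OF p(2) U(2) _ r(2)] part_fin[OF p(1) U(1)] part_fin[OF p(2) U(2)] in auto)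
  then show "trans2 (subst2 F G H) U1 U2 \<rho>1 \<rho>2 s =
     trans2 (subst2 F G H) V1 V2 \<tau>1 \<tau>2 (trans2 (subst2 F G H) U1 U2 \<sigma>1 \<sigma>2 s)"
    using trans_inner_comp[OF p(1) U(1) G f(1) b(1) c(1) r(1)] trans_inner_comp[OF p(2) U(2) H f(2) b(2) c(2) r(2)]
    by (simp add: subst2_def)
qed

text \<open>For \<open>G = H = E_plus\<close> the inner structures carry no information: a structure consists of the two
  partitions and an outer structure on them.\<close>

lemma PiE_E_plus:
  assumes "partition_on U P"
  shows "f \<in> (\<Pi>\<^sub>E B\<in>P. str1 E_plus B) \<longleftrightarrow> f = restrict id P"
proof -
  have "B \<noteq> {}" if "B \<in> P" for B using that assms by (auto simp: partition_on_def)
  then have "(\<Pi>\<^sub>E B\<in>P. str1 E_plus B) = (\<Pi>\<^sub>E B\<in>P. {id B})"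
    by (intro PiE_cong) (simp add: E_plus_def)
  also have "f \<in> \<dots> \<longleftrightarrow> f = restrict id P"
    unfolding PiE_iff extensional_def restrict_def fun_eq_iff by (simp, metis)
  finally show ?thesis .
qed

lemma subst2_E_plus_str:
  "s \<in> str2 (subst2 F E_plus E_plus) U1 U2 \<longleftrightarrow>
    partition_on U1 (part1 s) \<and> partition_on U2 (part2 s) \<and>
    outer s \<in> str2 F (node ` part1 s) (node ` part2 s) \<and>
    inner1 s = restrict id (part1 s) \<and> inner2 s = restrict id (part2 s)"
  using PiE_E_plus[of U1 "part1 s" "inner1 s"] PiE_E_plus[of U2 "part2 s" "inner2 s"]
  by (simp add: subst2_def cong: conj_cong)

end

theory Submission
  imports Defs
begin

text \<open>
  In a bicolored graph, call two vertices of the same color twins if they have the same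
  neighborhood.  Adjacency does not change when a vertex is replaced by a twin, so it descends to
  the classes of twins, and two distinct classes of the same color have distinct neighborhoods:
  the quotient is semi-point-determining.  Conversely, a semi-point-determining graph whose
  vertices are the blocks of two partitions is inflated to a graph on the points by joining two
  points whenever their blocks are joined.  The theorem says that these constructions are inverse
  to each other and natural.

  All of this is easier for relations than for graphs.  A bicolored graph on
  \<open>(U1, U2)\<close> is the same thing as a relation \<open>R \<subseteq> U1 \<times> U2\<close>, and it is
  semi-point-determining exactly if \<open>R\<close> and its converse have pairwise distinct images of
  points.  Each statement about relations therefore gives two statements about graphs, one for
  each color, by passing to the converse.  A structure of the substituted species amounts to two
  partitions \<open>P\<close>, \<open>Q\<close> and a relation \<open>T\<close> between their blocks that
  separates them on both sides, and inflation sends \<open>T\<close> to the union of the rectangles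
  \<open>A \<times> B\<close> with \<open>(A, B) \<in> T\<close>.

  The isomorphism is built in the direction of inflation, since a union of rectangles obviously
  commutes with relabeling, while naturality of the quotient would need an argument.  Inflation is
  injective because \<open>P\<close> and \<open>Q\<close> are recovered as the classes of twins
  (\<open>blocks_eq_fibers\<close>) and \<open>T\<close> as the set of pairs of blocks that are met by an
  edge (\<open>block_relation_inflate\<close>); it is surjective because the classes of twins of any
  relation give such a triple (\<open>inflate_surj\<close>).
\<close>

section \<open>Symmetry of isomorphism of species\<close>

text \<open>
  The inverses of the bijections are natural: apply the naturality of \<open>\<phi>\<close> to the
  preimage of a structure.
\<close>

lemma species2_iso_sym:
  assumes "F \<simeq>\<^sub>2 G"
  shows "G \<simeq>\<^sub>2 F"
proof -
  from assms obtain \<phi> where F: "is_species2 F" and G: "is_species2 G"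
    and bij': "\<forall>U1 U2. finite U1 \<and> finite U2 \<longrightarrow>
      bij_betw (\<phi> U1 U2) (str2 F U1 U2) (str2 G U1 U2)"
    and nat: "\<forall>U1 U2 V1 V2 \<sigma>1 \<sigma>2 s. finite U1 \<and> finite U2 \<and>
      bij_betw \<sigma>1 U1 V1 \<and> bij_betw \<sigma>2 U2 V2 \<and> s \<in> str2 F U1 U2 \<longrightarrow>
      \<phi> V1 V2 (trans2 F U1 U2 \<sigma>1 \<sigma>2 s) = trans2 G U1 U2 \<sigma>1 \<sigma>2 (\<phi> U1 U2 s)"
    unfolding species2_iso_def by (elim conjE exE) (rule that)
  have bij: "bij_betw (\<phi> U1 U2) (str2 F U1 U2) (str2 G U1 U2)" if "finite U1" "finite U2" for U1 U2
    using bij' that by simp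
  let ?\<psi> = "\<lambda>U1 U2. inv_into (str2 F U1 U2) (\<phi> U1 U2)"
  have "?\<psi> V1 V2 (trans2 G U1 U2 \<sigma>1 \<sigma>2 t) = trans2 F U1 U2 \<sigma>1 \<sigma>2 (?\<psi> U1 U2 t)"
    if U: "finite U1" "finite U2" and \<sigma>: "bij_betw \<sigma>1 U1 V1" "bij_betw \<sigma>2 U2 V2"
      and t: "t \<in> str2 G U1 U2" for U1 U2 V1 V2 \<sigma>1 \<sigma>2 t
  proof -
    have V: "finite V1" "finite V2" using U \<sigma> bij_betw_finite by blast+
    let ?s = "?\<psi> U1 U2 t"
    have s: "?s \<in> str2 F U1 U2"
      using bij_betwE[OF bij_betw_inv_into[OF bij[OF U]]] t by blast
    have "\<phi> V1 V2 (trans2 F U1 U2 \<sigma>1 \<sigma>2 ?s) = trans2 G U1 U2 \<sigma>1 \<sigma>2 t"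
      using nat[rule_format, of U1 U2 \<sigma>1 V1 \<sigma>2 V2 ?s] U \<sigma> s bij_betw_inv_into_right[OF bij[OF U] t] by simp
    then show ?thesis
      using bij_betw_inv_into_left[OF bij[OF V] is_species2D(2)[OF F U \<sigma> s]] by simp
  qed
  then show ?thesis
    unfolding species2_iso_def using F G bij_betw_inv_into[OF bij]
    by (intro conjI exI[of _ ?\<psi>]) simp_all
qed


section \<open>Bicolored graphs as relations\<close>

text \<open>
  The bicolored graphs with color classes \<open>U1\<close>, \<open>U2\<close> are the graphs
  \<open>bigraph U1 U2 R\<close> with \<open>R \<subseteq> U1 \<times> U2\<close>, and
  \<open>edge_relation\<close> recovers \<open>R\<close>.
\<close>

definition bigraph :: "'w set \<Rightarrow> 'b set \<Rightarrow> ('w \<times> 'b) set \<Rightarrow> ('w, 'b) colored_graph" where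
  "bigraph U1 U2 R =
    \<lparr>verts = White ` U1 \<union> Black ` U2, edges = (\<lambda>(a, b). {White a, Black b}) ` R\<rparr>"

definition edge_relation :: "('w, 'b) colored_graph \<Rightarrow> ('w \<times> 'b) set" where
  "edge_relation g = {(a, b). adjacent g (White a) (Black b)}"

lemma adjacent_bigraph [simp]:
  "adjacent (bigraph U1 U2 R) (White a) (Black b) \<longleftrightarrow> (a, b) \<in> R"
  "adjacent (bigraph U1 U2 R) (Black b) (White a) \<longleftrightarrow> (a, b) \<in> R"
  "\<not> adjacent (bigraph U1 U2 R) (White a) (White a')"
  "\<not> adjacent (bigraph U1 U2 R) (Black b) (Black b')"
  by (auto simp: adjacent_def bigraph_def doubleton_eq_iff image_iff)

lemma edge_relation_bigraph [simp]: "edge_relation (bigraph U1 U2 R) = R"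
  by (simp add: edge_relation_def)

lemma color_sets_bigraph [simp]:
  "white_set (bigraph U1 U2 R) = U1" "black_set (bigraph U1 U2 R) = U2"
  by (auto simp: white_set_def black_set_def bigraph_def)

lemma bicolored_graph_bigraph:
  assumes "finite U1" "finite U2" "R \<subseteq> U1 \<times> U2"
  shows "bicolored_graph (bigraph U1 U2 R)"
proof -
  have "\<not> same_color x y" if "adjacent (bigraph U1 U2 R) x y" for x y
    using that by (cases x; cases y) auto
  moreover have "simple_graph (bigraph U1 U2 R)"
    using assms(3) by (auto simp: simple_graph_def bigraph_def)
  moreover have "finite (verts (bigraph U1 U2 R))"
    using assms(1,2) by (simp add: bigraph_def)
  ultimately show ?thesis
    unfolding bicolored_graph_def by blast
qed

text \<open>
  An edge joins two vertices of different colors, so it is an unordered pair consisting of one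
  white and one black vertex, which determine an ordered pair of labels.
\<close>

lemma bicolored_graph_eq_bigraph:
  assumes g: "bicolored_graph g" "white_set g = U1" "black_set g = U2"
  shows "edge_relation g \<subseteq> U1 \<times> U2" "g = bigraph U1 U2 (edge_relation g)"
proof -
  show "edge_relation g \<subseteq> U1 \<times> U2"
    using edge_subset[OF g(1)] g(2,3)
    by (fastforce simp: edge_relation_def adjacent_def white_set_def black_set_def)
  have "e \<in> (\<lambda>(a, b). {White a, Black b}) ` edge_relation g" if e: "e \<in> edges g" for e
  proof -
    obtain x y where xy: "e = {x, y}"
      using g(1) e by (auto simp: bicolored_graph_def simple_graph_def card_2_iff)
    then have "\<not> same_color x y"
      using g(1) e edge_subset[OF g(1) e] by (auto simp: bicolored_graph_def adjacent_def)
    then obtain a b where "e = {White a, Black b}"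
      using xy by (cases x; cases y) (auto simp: insert_commute)
    then show ?thesis
      using e by (auto simp: edge_relation_def adjacent_def)
  qed
  then have "edges g = (\<lambda>(a, b). {White a, Black b}) ` edge_relation g"
    by (auto simp: edge_relation_def adjacent_def)
  then show "g = bigraph U1 U2 (edge_relation g)"
    using verts_eq[OF g(2,3)] by (simp add: bigraph_def)
qed

lemma relabel_bigraph:
  "relabel \<sigma>1 \<sigma>2 (bigraph U1 U2 R) = bigraph (\<sigma>1 ` U1) (\<sigma>2 ` U2) (map_prod \<sigma>1 \<sigma>2 ` R)"
  by (simp add: relabel_def bigraph_def image_Un image_image case_prod_unfold)

text \<open>
  One half of semi-point-determination: the points of \<open>A\<close> are distinguished by their
  neighborhoods.  The other half is the same condition on the converse relation.
\<close>

definition separated :: "'a set \<Rightarrow> ('a \<times> 'b) set \<Rightarrow> bool" where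
  "separated A R \<longleftrightarrow> inj_on (\<lambda>a. R `` {a}) A"

lemma semi_point_determining_bigraph:
  assumes "R \<subseteq> U1 \<times> U2"
  shows "semi_point_determining (bigraph U1 U2 R) \<longleftrightarrow> separated U1 R \<and> separated U2 (R\<inverse>)"
proof -
  let ?g = "bigraph U1 U2 R"
  have v: "verts ?g = White ` U1 \<union> Black ` U2"
    by (simp add: bigraph_def)
  have w: "neighborhood ?g (White a) = Black ` (R `` {a})" for a
    using assms by (auto simp: neighborhood_def v)
  have b: "neighborhood ?g (Black b) = White ` (R\<inverse> `` {b})" for b
    using assms by (auto simp: neighborhood_def v)
  have inj: "inj White" "inj Black"
    by (auto simp: inj_def)
  have "semi_point_determining ?g \<longleftrightarrow>
      (\<forall>a\<in>U1. \<forall>a'\<in>U1. a \<noteq> a' \<longrightarrow> neighborhood ?g (White a) \<noteq> neighborhood ?g (White a')) \<and>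
      (\<forall>b\<in>U2. \<forall>b'\<in>U2. b \<noteq> b' \<longrightarrow> neighborhood ?g (Black b) \<noteq> neighborhood ?g (Black b'))"
    unfolding semi_point_determining_def v by (simp add: ball_Un)
  also have "\<dots> \<longleftrightarrow> separated U1 R \<and> separated U2 (R\<inverse>)"
    unfolding w b inj_image_eq_iff[OF inj(1)] inj_image_eq_iff[OF inj(2)] separated_def inj_on_def
    by blast
  finally show ?thesis .
qed

text \<open>
  This lets separation pass between blocks and graph labels: the outer graph has the points \<open>node A\<close> as labels, and not the blocks
  \<open>A\<close> themselves.
\<close>

lemma separated_image:
  assumes "inj_on f A" "inj_on g B" "R \<subseteq> A \<times> B"
  shows "separated (f ` A) (map_prod f g ` R) \<longleftrightarrow> separated A R"
proof -
  have nb: "(map_prod f g ` R) `` {f a} = g ` (R `` {a})" if "a \<in> A" for a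
  proof (intro equalityI subsetI)
    fix z assume "z \<in> (map_prod f g ` R) `` {f a}"
    then obtain a' b where R: "(a', b) \<in> R" "f a' = f a" "z = g b"
      by auto
    then have "a' = a"
      using assms(1,3) that by (auto dest: inj_onD)
    then show "z \<in> g ` (R `` {a})"
      using R by blast
  next
    fix z assume "z \<in> g ` (R `` {a})"
    then obtain b where "(a, b) \<in> R" "z = g b"
      by blast
    then show "z \<in> (map_prod f g ` R) `` {f a}"
      using map_prod_imageI[of a b R f g] by blast
  qed
  have "g ` (R `` {a}) = g ` (R `` {a'}) \<longleftrightarrow> R `` {a} = R `` {a'}" for a a'
    using assms(3) by (intro inj_on_image_eq_iff[OF assms(2)]) auto
  then have "separated (f ` A) (map_prod f g ` R) \<longleftrightarrow>
      (\<forall>a\<in>A. \<forall>a'\<in>A. R `` {a} = R `` {a'} \<longrightarrow> f a = f a')"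
    by (simp add: separated_def inj_on_def nb)
  also have "\<dots> \<longleftrightarrow> separated A R"
    using assms(1) by (auto simp: separated_def inj_on_def)
  finally show ?thesis .
qed


section \<open>Fibers\<close>

definition fibers :: "('a \<Rightarrow> 'b) \<Rightarrow> 'a set \<Rightarrow> 'a set set" where
  "fibers f U = (\<lambda>x. {y \<in> U. f y = f x}) ` U"

lemma partition_on_fibers: "partition_on U (fibers f U)"
  by (auto simp: partition_on_def fibers_def disjoint_def)

lemma in_fiber_unique: "A \<in> fibers f U \<Longrightarrow> a \<in> A \<Longrightarrow> A = {x \<in> U. f x = f a}"
  by (auto simp: fibers_def)

text \<open>
  How a partition is recovered from the graph: it is enough that some function of the points is
  constant on each block and separates the blocks.  Since no block is empty, each of them is then
  the fiber of any of its points.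
\<close>

lemma partition_eq_fibers:
  assumes P: "partition_on U P"
    and f: "\<And>A A' a a'. A \<in> P \<Longrightarrow> A' \<in> P \<Longrightarrow> a \<in> A \<Longrightarrow> a' \<in> A' \<Longrightarrow> f a = f a' \<longleftrightarrow> A = A'"
  shows "P = fibers f U"
proof -
  have U: "\<Union>P = U" and ne: "{} \<notin> P"
    using P by (auto simp: partition_on_def)
  have A: "A = {x \<in> U. f x = f a}" if "A \<in> P" "a \<in> A" for A a
    using that f U by blast
  show ?thesis
  proof
    show "P \<subseteq> fibers f U"
    proof
      fix A assume "A \<in> P"
      then obtain a where "a \<in> A" using ne by fastforce
      then show "A \<in> fibers f U"
        using A \<open>A \<in> P\<close> U by (auto simp: fibers_def)
    qed
    show "fibers f U \<subseteq> P"
    proof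
      fix A assume "A \<in> fibers f U"
      then obtain a where "a \<in> U" "A = {x \<in> U. f x = f a}"
        by (auto simp: fibers_def)
      moreover obtain A' where "A' \<in> P" "a \<in> A'"
        using \<open>a \<in> U\<close> U by blast
      ultimately show "A \<in> P"
        using A by simp
    qed
  qed
qed


section \<open>Inflation of a relation between blocks\<close>

definition inflate :: "('a set \<times> 'b set) set \<Rightarrow> ('a \<times> 'b) set" where
  "inflate T = (\<Union>(A, B)\<in>T. A \<times> B)"

definition block_relation :: "'a set set \<Rightarrow> 'b set set \<Rightarrow> ('a \<times> 'b) set \<Rightarrow> ('a set \<times> 'b set) set" where
  "block_relation P Q R = {(A, B) \<in> P \<times> Q. A \<times> B \<inter> R \<noteq> {}}"

lemma inflate_converse: "inflate (T\<inverse>) = (inflate T)\<inverse>"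
  by (auto simp: inflate_def)

lemma inflate_image:
  "inflate (map_prod (image f) (image g) ` T) = map_prod f g ` inflate T"
  by (force simp: inflate_def)

lemma inflate_subset:
  "partition_on U1 P \<Longrightarrow> partition_on U2 Q \<Longrightarrow> T \<subseteq> P \<times> Q \<Longrightarrow> inflate T \<subseteq> U1 \<times> U2"
  by (fastforce simp: inflate_def partition_on_def)

lemma same_block:
  "partition_on U P \<Longrightarrow> A \<in> P \<Longrightarrow> A' \<in> P \<Longrightarrow> a \<in> A \<Longrightarrow> a \<in> A' \<Longrightarrow> A = A'"
  by (auto simp: partition_on_def disjoint_def)

text \<open>
  A block belongs to a set of blocks exactly if it meets their union.  This uses that blocks are
  nonempty as well as disjoint.
\<close>

lemma inj_on_Union_blocks:
  assumes "partition_on U P"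
  shows "inj_on Union (Pow P)"
proof -
  \<comment> \<open>This formula is also the left inverse of the union.\<close>
  have "\<A> = {A \<in> P. A \<inter> \<Union>\<A> \<noteq> {}}" if \<A>: "\<A> \<subseteq> P" for \<A>
  proof (intro equalityI subsetI)
    fix A assume "A \<in> \<A>"
    moreover have "A \<noteq> {}"
      using assms \<A> \<open>A \<in> \<A>\<close> by (auto simp: partition_on_def)
    ultimately show "A \<in> {A \<in> P. A \<inter> \<Union>\<A> \<noteq> {}}"
      using \<A> by blast
  next
    fix A assume "A \<in> {A \<in> P. A \<inter> \<Union>\<A> \<noteq> {}}"
    then obtain A' a where "A \<in> P" "A' \<in> \<A>" "a \<in> A" "a \<in> A'"
      by blast
    then show "A \<in> \<A>"
      using same_block[OF assms, of A A' a] \<A> by blast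
  qed
  then show ?thesis
    by (intro inj_on_inverseI[where g = "\<lambda>S. {A \<in> P. A \<inter> S \<noteq> {}}"]) simp
qed

lemma neighbors_inflate:
  assumes "partition_on U P" "T \<subseteq> P \<times> Q" "A \<in> P" "a \<in> A"
  shows "inflate T `` {a} = \<Union> (T `` {A})"
proof -
  have "(\<exists>A'. (A', B) \<in> T \<and> a \<in> A') \<longleftrightarrow> (A, B) \<in> T" for B
    using assms(2-4) same_block[OF assms(1) assms(3) _ assms(4)] by blast
  then have "b \<in> inflate T `` {a} \<longleftrightarrow> b \<in> \<Union> (T `` {A})" for b
    unfolding inflate_def by blast
  then show ?thesis
    by blast
qed

text \<open>
  The neighborhood of a point \<open>a\<close> in \<open>A\<close> is the union of the blocks that are
  neighbors of \<open>A\<close>.  This union determines the set of these blocks, and hence, by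
  separation, \<open>A\<close> itself.
\<close>

lemma blocks_eq_fibers:
  assumes P: "partition_on U1 P" and Q: "partition_on U2 Q" and T: "T \<subseteq> P \<times> Q"
    and sep: "separated P T"
  shows "P = fibers (\<lambda>a. inflate T `` {a}) U1"
proof (rule partition_eq_fibers[OF P])
  fix A A' a a'
  assume A: "A \<in> P" "A' \<in> P" and a: "a \<in> A" "a' \<in> A'"
  have "inflate T `` {a} = inflate T `` {a'} \<longleftrightarrow> \<Union> (T `` {A}) = \<Union> (T `` {A'})"
    using neighbors_inflate[OF P T] A a by simp
  also have "\<dots> \<longleftrightarrow> T `` {A} = T `` {A'}"
    using T by (intro inj_on_eq_iff[OF inj_on_Union_blocks[OF Q]]) auto
  also have "\<dots> \<longleftrightarrow> A = A'"
    using sep A by (auto simp: separated_def inj_on_def)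
  finally show "inflate T `` {a} = inflate T `` {a'} \<longleftrightarrow> A = A'" .
qed

lemma block_relation_inflate:
  assumes P: "partition_on U1 P" and Q: "partition_on U2 Q" and T: "T \<subseteq> P \<times> Q"
  shows "block_relation P Q (inflate T) = T"
proof -
  have "(A, B) \<in> block_relation P Q (inflate T) \<longleftrightarrow> (A, B) \<in> T" for A B
  proof
    assume "(A, B) \<in> block_relation P Q (inflate T)"
    then obtain a b A' B' where "A \<in> P" "B \<in> Q" "a \<in> A" "b \<in> B" "(A', B') \<in> T" "a \<in> A'" "b \<in> B'"
      unfolding block_relation_def inflate_def by blast
    then show "(A, B) \<in> T"
      using T same_block[OF P, of A A' a] same_block[OF Q, of B B' b] by blast
  next
    assume AB: "(A, B) \<in> T"
    then have "A \<in> P" "B \<in> Q"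
      using T by auto
    moreover from this have "A \<noteq> {}" "B \<noteq> {}"
      using P Q by (auto simp: partition_on_def)
    ultimately show "(A, B) \<in> block_relation P Q (inflate T)"
      using AB unfolding block_relation_def inflate_def by blast
  qed
  then show ?thesis
    by auto
qed

lemma inflate_inject:
  assumes "partition_on U1 P" "partition_on U2 Q" "T \<subseteq> P \<times> Q" "separated P T" "separated Q (T\<inverse>)"
    and "partition_on U1 P'" "partition_on U2 Q'" "T' \<subseteq> P' \<times> Q'" "separated P' T'" "separated Q' (T'\<inverse>)"
    and "inflate T = inflate T'"
  shows "P = P'" "Q = Q'" "T = T'"
proof -
  show P: "P = P'"
    unfolding blocks_eq_fibers[OF assms(1-4)] blocks_eq_fibers[OF assms(6-9)] assms(11) ..
  have "T\<inverse> \<subseteq> Q \<times> P" "T'\<inverse> \<subseteq> Q' \<times> P'"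
    using assms(3,8) by auto
  note Q_fibers = blocks_eq_fibers[OF assms(2,1) this(1) assms(5)]
    blocks_eq_fibers[OF assms(7,6) this(2) assms(10)]
  show Q: "Q = Q'"
    unfolding Q_fibers inflate_converse assms(11) ..
  have "T = block_relation P Q (inflate T)"
    using block_relation_inflate[OF assms(1-3)] by (rule sym)
  also have "\<dots> = block_relation P' Q' (inflate T')"
    unfolding P[symmetric] Q[symmetric] assms(11) ..
  also have "\<dots> = T'"
    by (rule block_relation_inflate[OF assms(6-8)])
  finally show "T = T'" .
qed

text \<open>
  If the blocks of one partition are the classes of twins of the inflated relation, then two
  blocks with the same neighboring blocks contain twins, so they are equal.
\<close>

lemma separated_fibers:
  assumes T: "T \<subseteq> fibers (\<lambda>a. inflate T `` {a}) U \<times> Q"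
  shows "separated (fibers (\<lambda>a. inflate T `` {a}) U) T"
  unfolding separated_def
proof (rule inj_onI)
  let ?P = "fibers (\<lambda>a. inflate T `` {a}) U"
  note P = partition_on_fibers[of U "\<lambda>a. inflate T `` {a}"]
  fix A A' assume A: "A \<in> ?P" "A' \<in> ?P" and eq: "T `` {A} = T `` {A'}"
  have "A \<noteq> {}" "A' \<noteq> {}"
    using A P by (auto simp: partition_on_def)
  then obtain a a' where a: "a \<in> A" "a' \<in> A'"
    by blast
  have "inflate T `` {a} = inflate T `` {a'}"
    using neighbors_inflate[OF P T] A a eq by simp
  then show "A = A'"
    using in_fiber_unique[OF A(1) a(1)] in_fiber_unique[OF A(2) a(2)] by simp
qed

text \<open>
  Take for \<open>P\<close> and \<open>Q\<close> the classes of twins on either side.  If one point of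
  \<open>A\<close> is joined to one point of \<open>B\<close>, then all points are, since either
  endpoint may be replaced by a twin; so inflating the relation induced on the blocks gives
  \<open>R\<close> back.
\<close>

lemma inflate_surj:
  assumes R: "R \<subseteq> U1 \<times> U2"
  obtains P Q T where "partition_on U1 P" "partition_on U2 Q" "T \<subseteq> P \<times> Q"
    "separated P T" "separated Q (T\<inverse>)" "inflate T = R"
proof -
  define P where "P = fibers (\<lambda>a. R `` {a}) U1"
  define Q where "Q = fibers (\<lambda>b. R\<inverse> `` {b}) U2"
  define T where "T = block_relation P Q R"
  have P: "partition_on U1 P" and Q: "partition_on U2 Q"
    by (simp_all add: P_def Q_def partition_on_fibers)
  have T: "T \<subseteq> P \<times> Q"
    by (auto simp: T_def block_relation_def)
  have inf: "inflate T = R"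
  proof
    show "inflate T \<subseteq> R"
    proof clarify
      fix a b assume "(a, b) \<in> inflate T"
      then obtain A B a' b' where A: "A \<in> P" "a \<in> A" "a' \<in> A" and B: "B \<in> Q" "b \<in> B" "b' \<in> B"
        and "(a', b') \<in> R"
        unfolding inflate_def T_def block_relation_def by blast
      have "R `` {a} = R `` {a'}"
        using in_fiber_unique[of A _ U1 a'] A unfolding P_def by auto
      moreover have "R\<inverse> `` {b} = R\<inverse> `` {b'}"
        using in_fiber_unique[of B _ U2 b'] B unfolding Q_def by auto
      ultimately show "(a, b) \<in> R"
        using \<open>(a', b') \<in> R\<close> by blast
    qed
    show "R \<subseteq> inflate T"
    proof clarify
      fix a b assume ab: "(a, b) \<in> R"
      then obtain A B where "A \<in> P" "a \<in> A" "B \<in> Q" "b \<in> B"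
        using R P Q by (auto simp: partition_on_def)
      then show "(a, b) \<in> inflate T"
        using ab unfolding inflate_def T_def block_relation_def by blast
    qed
  qed
  have "separated P T"
    using separated_fibers[of T U1 Q] T by (simp add: inf P_def)
  moreover have "separated Q (T\<inverse>)"
    using separated_fibers[of "T\<inverse>" U2 P] T by (simp add: inflate_converse inf Q_def) auto
  ultimately show ?thesis
    using that P Q T inf by blast
qed


section \<open>Structures of the substitution\<close>

text \<open>
  The structure of the substituted species given by two partitions and a relation between their
  blocks.  The inner structures are forced, since a block carries only one
  \<open>E_plus\<close>-structure.
\<close>

definition blocks_structure ::
  "'a hfset set set \<Rightarrow> 'a hfset set set \<Rightarrow> ('a hfset set \<times> 'a hfset set) set \<Rightarrow>
    ('a hfset, ('a hfset, 'a hfset) colored_graph, 'a hfset set, 'a hfset set) subst_structure" where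
  "blocks_structure P Q T =
    \<lparr>part1 = P, part2 = Q, outer = bigraph (node ` P) (node ` Q) (map_prod node node ` T),
     inner1 = restrict id P, inner2 = restrict id Q\<rparr>"

lemma inj_on_node_blocks: "partition_on U P \<Longrightarrow> finite U \<Longrightarrow> inj_on node P"
  by (meson blk_fin inj_onI node_inj)

text \<open>
  On partitions of finite sets \<open>node\<close> is injective, so outer graphs on the nodes
  correspond to relations between the blocks, and this correspondence preserves separation on
  both sides.
\<close>

lemma subst2_spd_structures:
  assumes U: "finite U1" "finite U2"
  shows "s \<in> str2 (subst2 spd_bicolored_graphs E_plus E_plus) U1 U2 \<longleftrightarrow>
    (\<exists>P Q T. s = blocks_structure P Q T \<and> partition_on U1 P \<and> partition_on U2 Q \<and> T \<subseteq> P \<times> Q \<and>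
      separated P T \<and> separated Q (T\<inverse>))" (is "?L \<longleftrightarrow> ?R")
proof -
  have spd: "semi_point_determining (bigraph (node ` P) (node ` Q) (map_prod node node ` T)) \<longleftrightarrow>
      separated P T \<and> separated Q (T\<inverse>)"
    if P: "partition_on U1 P" and Q: "partition_on U2 Q" and T: "T \<subseteq> P \<times> Q"
    for P Q :: "'a hfset set set" and T
  proof -
    note inj = inj_on_node_blocks[OF P U(1)] inj_on_node_blocks[OF Q U(2)]
    have "(map_prod node node ` T)\<inverse> = map_prod node node ` (T\<inverse>)"
      by force
    moreover have "T\<inverse> \<subseteq> Q \<times> P" "map_prod node node ` T \<subseteq> node ` P \<times> node ` Q"
      using T by auto
    ultimately show ?thesis
      by (simp add: semi_point_determining_bigraph separated_image[OF inj T]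
          separated_image[OF inj(2,1)])
  qed
  show ?thesis
  proof
    assume ?L
    then have P: "partition_on U1 (part1 s)" and Q: "partition_on U2 (part2 s)"
      and g: "bicolored_graph (outer s)" "white_set (outer s) = node ` part1 s"
        "black_set (outer s) = node ` part2 s"
      and d: "semi_point_determining (outer s)"
      and i: "inner1 s = restrict id (part1 s)" "inner2 s = restrict id (part2 s)"
      by (auto simp: subst2_E_plus_str spd_bicolored_graphs_def)
    let ?T = "{(A, B) \<in> part1 s \<times> part2 s. (node A, node B) \<in> edge_relation (outer s)}"
    have T: "map_prod node node ` ?T = edge_relation (outer s)"
      using bicolored_graph_eq_bigraph(1)[OF g] by force
    then have o: "outer s = bigraph (node ` part1 s) (node ` part2 s) (map_prod node node ` ?T)"
      using bicolored_graph_eq_bigraph(2)[OF g] by simp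
    have "separated (part1 s) ?T \<and> separated (part2 s) (?T\<inverse>)"
      using d spd[OF P Q, of ?T] o by auto
    moreover have "s = blocks_structure (part1 s) (part2 s) ?T"
      using o i by (simp add: blocks_structure_def)
    ultimately show ?R
      using P Q by (intro exI[of _ "part1 s"] exI[of _ "part2 s"] exI[of _ ?T]) auto
  next
    assume ?R
    then obtain P Q T where s: "s = blocks_structure P Q T"
      and P: "partition_on U1 P" and Q: "partition_on U2 Q" and T: "T \<subseteq> P \<times> Q"
      and sep: "separated P T" "separated Q (T\<inverse>)"
      by blast
    have "bicolored_graph (bigraph (node ` P) (node ` Q) (map_prod node node ` T))"
      using T part_fin[OF P U(1)] part_fin[OF Q U(2)] by (intro bicolored_graph_bigraph) auto
    then show ?L
      using P Q spd[OF P Q T] sep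
      by (simp add: s subst2_E_plus_str spd_bicolored_graphs_def blocks_structure_def)
  qed
qed

text \<open>
  The transported inner structures need no computation: they form a family of
  \<open>E_plus\<close>-structures on the new blocks, and there is only one.
\<close>

lemma transport_blocks_structure:
  assumes U: "finite U1" "finite U2" and \<sigma>: "bij_betw \<sigma>1 U1 V1" "bij_betw \<sigma>2 U2 V2"
    and P: "partition_on U1 P" and Q: "partition_on U2 Q" and T: "T \<subseteq> P \<times> Q"
  shows "trans2 (subst2 spd_bicolored_graphs E_plus E_plus) U1 U2 \<sigma>1 \<sigma>2 (blocks_structure P Q T) =
    blocks_structure (image \<sigma>1 ` P) (image \<sigma>2 ` Q) (map_prod (image \<sigma>1) (image \<sigma>2) ` T)"
proof -
  have inner: "trans_inner E_plus U X \<sigma> (restrict id X) = restrict id (image \<sigma> ` X)"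
    if X: "partition_on U X" "finite U" and "bij_betw \<sigma> U V"
    for U V X and \<sigma> :: "'a hfset \<Rightarrow> 'a hfset"
  proof -
    have "restrict id X \<in> (\<Pi>\<^sub>E B\<in>X. str1 E_plus B)"
      by (simp add: PiE_E_plus[OF X(1)])
    then have "trans_inner E_plus U X \<sigma> (restrict id X) \<in> (\<Pi>\<^sub>E C\<in>image \<sigma> ` X. str1 E_plus C)"
      using that by (intro trans_inner_maps is_species1_E_plus) (auto simp: bij_betw_def)
    then show ?thesis
      using PiE_E_plus[OF part_image[OF that]] by blast
  qed
  have ob: "on_blocks \<sigma>1 (node A) = node (\<sigma>1 ` A)" if "A \<in> P" for A
    using blk_fin[OF P U(1) that] by (rule on_blocks_node)
  have ob': "on_blocks \<sigma>2 (node B) = node (\<sigma>2 ` B)" if "B \<in> Q" for B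
    using blk_fin[OF Q U(2) that] by (rule on_blocks_node)
  have "on_blocks \<sigma>1 ` node ` P = node ` image \<sigma>1 ` P" "on_blocks \<sigma>2 ` node ` Q = node ` image \<sigma>2 ` Q"
    by (auto simp: image_image ob ob' cong: image_cong)
  moreover have "map_prod (on_blocks \<sigma>1) (on_blocks \<sigma>2) ` map_prod node node ` T =
      map_prod node node ` map_prod (image \<sigma>1) (image \<sigma>2) ` T"
    unfolding image_image using T by (intro image_cong) (auto simp: ob ob')
  ultimately show ?thesis
    using inner[OF P U(1) \<sigma>(1)] inner[OF Q U(2) \<sigma>(2)]
    by (simp add: subst2_def spd_bicolored_graphs_def blocks_structure_def relabel_bigraph)
qed


section \<open>The isomorphism\<close>

text \<open>
  The labels of the outer graph are nodes; \<open>elems\<close> turns them back into blocks.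
\<close>

definition inflated_graph ::
  "'a hfset set \<Rightarrow> 'a hfset set \<Rightarrow>
    ('a hfset, ('a hfset, 'a hfset) colored_graph, 'a hfset set, 'a hfset set) subst_structure \<Rightarrow>
    ('a hfset, 'a hfset) colored_graph" where
  "inflated_graph U1 U2 s =
    bigraph U1 U2 (inflate (map_prod elems elems ` edge_relation (outer s)))"

lemma inflated_graph_blocks_structure:
  assumes U: "finite U1" "finite U2"
    and P: "partition_on U1 P" and Q: "partition_on U2 Q" and T: "T \<subseteq> P \<times> Q"
  shows "inflated_graph V1 V2 (blocks_structure P Q T) = bigraph V1 V2 (inflate T)"
proof -
  have "map_prod elems elems ` map_prod node node ` T = id ` T"
    unfolding image_image using T blk_fin[OF P U(1)] blk_fin[OF Q U(2)]
    by (intro image_cong) auto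
  then show ?thesis
    by (simp add: inflated_graph_def blocks_structure_def)
qed

lemma inflated_graph_bij:
  assumes U: "finite U1" "finite U2"
  shows "bij_betw (inflated_graph U1 U2)
    (str2 (subst2 spd_bicolored_graphs E_plus E_plus) U1 U2) (str2 bicolored_graphs U1 U2)"
    (is "bij_betw _ ?S ?G")
proof -
  note S = subst2_spd_structures[OF U] and inf = inflated_graph_blocks_structure[OF U]
  have "inj_on (inflated_graph U1 U2) ?S"
  proof (rule inj_onI)
    fix s s' assume s: "s \<in> ?S" and s': "s' \<in> ?S"
      and eq: "inflated_graph U1 U2 s = inflated_graph U1 U2 s'"
    obtain P Q T where 1: "s = blocks_structure P Q T" and
      2: "partition_on U1 P" "partition_on U2 Q" "T \<subseteq> P \<times> Q" "separated P T" "separated Q (T\<inverse>)"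
      using s unfolding S by blast
    obtain P' Q' T' where 3: "s' = blocks_structure P' Q' T'" and
      4: "partition_on U1 P'" "partition_on U2 Q'" "T' \<subseteq> P' \<times> Q'" "separated P' T'" "separated Q' (T'\<inverse>)"
      using s' unfolding S by blast
    have "edge_relation (inflated_graph U1 U2 s) = edge_relation (inflated_graph U1 U2 s')"
      using eq by simp
    then have "inflate T = inflate T'"
      by (simp add: 1 3 inf[OF 2(1-3)] inf[OF 4(1-3)])
    then show "s = s'"
      using inflate_inject[OF 2 4] 1 3 by simp
  qed
  moreover have "inflated_graph U1 U2 s \<in> ?G" if "s \<in> ?S" for s
  proof -
    obtain P Q T where 1: "s = blocks_structure P Q T" and
      2: "partition_on U1 P" "partition_on U2 Q" "T \<subseteq> P \<times> Q"
      using \<open>s \<in> ?S\<close> unfolding S by blast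
    show ?thesis
      using bicolored_graph_bigraph[OF U inflate_subset[OF 2]]
      by (simp add: 1 inf[OF 2] bicolored_graphs_def)
  qed
  moreover have "g \<in> inflated_graph U1 U2 ` ?S" if "g \<in> ?G" for g
  proof -
    have g: "bicolored_graph g" "white_set g = U1" "black_set g = U2"
      using \<open>g \<in> ?G\<close> by (auto simp: bicolored_graphs_def)
    obtain P Q T where 2: "partition_on U1 P" "partition_on U2 Q" "T \<subseteq> P \<times> Q"
      and 3: "separated P T" "separated Q (T\<inverse>)" and "inflate T = edge_relation g"
      using inflate_surj[OF bicolored_graph_eq_bigraph(1)[OF g]] by blast
    then have "g = inflated_graph U1 U2 (blocks_structure P Q T)"
      using inf[OF 2] bicolored_graph_eq_bigraph(2)[OF g] by simp
    moreover have "blocks_structure P Q T \<in> ?S"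
      unfolding S using 2 3 by blast
    ultimately show ?thesis
      by blast
  qed
  ultimately show ?thesis
    unfolding bij_betw_def by blast
qed

lemma inflated_graph_natural:
  assumes U: "finite U1" "finite U2" and \<sigma>: "bij_betw \<sigma>1 U1 V1" "bij_betw \<sigma>2 U2 V2"
    and s: "s \<in> str2 (subst2 spd_bicolored_graphs E_plus E_plus) U1 U2"
  shows "inflated_graph V1 V2 (trans2 (subst2 spd_bicolored_graphs E_plus E_plus) U1 U2 \<sigma>1 \<sigma>2 s) =
    relabel \<sigma>1 \<sigma>2 (inflated_graph U1 U2 s)"
proof -
  obtain P Q T where s_eq: "s = blocks_structure P Q T" and
    s': "partition_on U1 P" "partition_on U2 Q" "T \<subseteq> P \<times> Q"
    using s unfolding subst2_spd_structures[OF U] by blast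
  have V: "finite V1" "finite V2"
    using U \<sigma> bij_betw_finite by blast+
  have V_eq: "V1 = \<sigma>1 ` U1" "V2 = \<sigma>2 ` U2"
    using \<sigma> by (auto simp: bij_betw_def)
  have "map_prod (image \<sigma>1) (image \<sigma>2) ` T \<subseteq> image \<sigma>1 ` P \<times> image \<sigma>2 ` Q"
    using s'(3) by auto
  then show ?thesis
    using part_image[OF s'(1) U(1) \<sigma>(1)] part_image[OF s'(2) U(2) \<sigma>(2)]
    by (simp add: inflated_graph_blocks_structure[OF V] s_eq transport_blocks_structure[OF U \<sigma> s'] inflated_graph_blocks_structure[OF U s']
        relabel_bigraph inflate_image flip: V_eq)
qed

theorem theorem5p4:
  shows "(bicolored_graphs :: ('a hfset, ('a hfset, 'a hfset) colored_graph) species2)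
           \<simeq>\<^sub>2 subst2 spd_bicolored_graphs E_plus E_plus"
proof (rule species2_iso_sym)
  let ?S = "subst2 spd_bicolored_graphs E_plus E_plus ::
    ('a hfset, ('a hfset, ('a hfset, 'a hfset) colored_graph, 'a hfset set, 'a hfset set) subst_structure) species2"
  have nat: "inflated_graph V1 V2 (trans2 ?S U1 U2 \<sigma>1 \<sigma>2 s) =
      trans2 bicolored_graphs U1 U2 \<sigma>1 \<sigma>2 (inflated_graph U1 U2 s)"
    if "finite U1" "finite U2" "bij_betw \<sigma>1 U1 V1" "bij_betw \<sigma>2 U2 V2" "s \<in> str2 ?S U1 U2"
    for U1 U2 V1 V2 \<sigma>1 \<sigma>2 s
    using inflated_graph_natural[OF that] by (simp add: bicolored_graphs_def)
  show "?S \<simeq>\<^sub>2 bicolored_graphs"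
    unfolding species2_iso_def
    using is_species2_subst2[OF is_species2_spd is_species1_E_plus is_species1_E_plus]
      is_species2_bicolored_graphs
    by (intro conjI exI[of _ inflated_graph]) (simp_all add: inflated_graph_bij nat)
qed

end
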